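(* Fix $\lambda\ge 2$ and $0<p<1$. If there exists at least one nontrivial zero $\rho$ of the Riemann zeta function with $\operatorname{Re}(\rho)\ne\tfrac12$, then $$\lim_{R\to\infty}\mathcal{W}(R)=\infty.$$
   Context: $\zeta(s)$ is the Riemann zeta function (meromorphically continued to $\mathbb{C}$); its nontrivial zeros are the zeros with $0<\operatorname{Re}(s)<1$, listed as $(\rho_k)_{k\ge1}$. Discs: $B(\rho_k,\varepsilon_k)=\{s\in\mathbb{C}:|s-\rho_k|<\varepsilon_k\}$ with radii $\varepsilon_k=(k+N_0)^{-\alpha}$, where $\alpha>1$ and $N_0\in\mathbb{R}$ are fixed (with $k+N_0>0$ for all $k\ge1$). For $R>0$ the regulated domain is $$\mathcal{D}_R^{\mathrm{reg}}:=\{s\in\mathbb{C}: \operatorname{Re}(s)\in[0,1],\ |\operatorname{Im}(s)|\le R\}\setminus\bigcup_k B(\rho_k,\varepsilon_k),$$ the union being over the zeros $\rho_k$ in the strip region, and the regulated normalized area integral is $$\mathcal{W}(R):=\frac{1}{2R}\iint_{\mathcal{D}_R^{\mathrm{reg}}}\frac{1}{|\zeta(s)|^{\lambda}\,|\operatorname{Re}(s)-\tfrac12|^{p}}\,dA(s),$$ with $dA$ two-dimensional Lebesgue measure. *)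

theory Defs
  imports "HOL-Complex_Analysis.Complex_Analysis"
begin

section \<open>The Riemann zeta function\<close>

text \<open>
  The zeta function is the analytic continuation of its Dirichlet series to the plane without
  the pole \<open>1\<close>; the value at the pole is set to \<open>0\<close> so that the description is unique.
  Existence and uniqueness are proved below in \<open>zeta_ex1\<close>.
\<close>

definition is_zeta :: "(complex \<Rightarrow> complex) \<Rightarrow> bool" where
  "is_zeta f \<longleftrightarrow> f holomorphic_on (- {1}) \<and>
     (\<forall>s. Re s > 1 \<longrightarrow> f s = (\<Sum>n. of_nat (Suc n) powr (- s))) \<and> f 1 = 0"

definition zeta :: "complex \<Rightarrow> complex" where
  "zeta = (THE f. is_zeta f)"

definition nontrivial_zeros :: "complex set" where
  "nontrivial_zeros = {s. zeta s = 0 \<and> 0 < Re s \<and> Re s < 1}"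


subsection \<open>Existence and uniqueness of the continuation\<close>

text \<open>
  Taylor expansion of \<open>(n + 1) powr (1 - s)\<close> around \<open>n\<close> and summation over \<open>n\<close> express
  \<open>(s - 1) * zeta s\<close> through the values of zeta at \<open>s + 1, s + 2, \<dots>\<close>, up to a remainder
  which is holomorphic on a larger half plane. This continues the function one unit at a time.
\<close>

lemma powr_Taylor_bound:
  fixes K :: real and m :: nat
  obtains C where "C \<ge> 0"
    "\<And>a x. norm (a::complex) \<le> K \<Longrightarrow> 0 \<le> x \<Longrightarrow> x \<le> 1 \<Longrightarrow>
       norm ((1 + of_real x) powr a - (\<Sum>i\<le>m. (a gchoose i) * of_real x ^ i)) \<le> C * x ^ Suc m"
proof -
  define F where "F = (\<lambda>(a::complex) i z. (\<Prod>l<i. a - of_nat l) * (1 + z) powr (a - of_nat i))"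
  define C where "C = (\<Prod>l<Suc m. \<bar>K\<bar> + real l) * 2 powr (\<bar>K\<bar> + real (Suc m)) / fact m"
  have C0: "C \<ge> 0" unfolding C_def by (intro divide_nonneg_nonneg mult_nonneg_nonneg prod_nonneg) auto
  moreover have "norm ((1 + of_real x) powr a - (\<Sum>i\<le>m. (a gchoose i) * of_real x ^ i)) \<le> C * x ^ Suc m"
    if a: "norm (a::complex) \<le> K" and x: "0 \<le> x" "x \<le> 1" for a x
  proof -
    define S where "S = closed_segment (0::complex) 1"
    have S: "\<exists>t. z = of_real t \<and> 0 \<le> t \<and> t \<le> 1" if "z \<in> S" for z
      using that unfolding S_def in_segment by (auto simp: scaleR_conv_of_real)
    have xS: "of_real x \<in> S" unfolding S_def in_segment using x
      by (intro exI[of _ x]) (auto simp: scaleR_conv_of_real)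
    have 1: "norm (F a 0 (of_real x) - (\<Sum>i\<le>m. F a i 0 * (of_real x - 0) ^ i / fact i))
        \<le> (C * fact m) * norm (of_real x - (0::complex)) ^ Suc m / fact m"
    proof (rule complex_Taylor[where S = S])
      show "convex S" unfolding S_def by simp
      show "0 \<in> S" unfolding S_def by simp
      show "of_real x \<in> S" by (rule xS)
    next
      fix i z assume z: "z \<in> S"
      obtain t where t: "z = of_real t" "0 \<le> t" "t \<le> 1" using S[OF z] by blast
      have nz: "1 + z \<notin> \<real>\<^sub>\<le>\<^sub>0" using t by (auto simp: complex_nonpos_Reals_iff)
      have "((\<lambda>z. (1 + z) powr (a - of_nat i)) has_field_derivative
               ((a - of_nat i) * (1 + z) powr (a - of_nat i - 1))) (at z)"
        by (rule DERIV_chain2[where f = "\<lambda>z. z powr (a - of_nat i)" and g = "\<lambda>z. 1 + z" and Db = 1, simplified])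
           (auto intro!: derivative_eq_intros has_field_derivative_powr nz)
      from DERIV_cmult[OF this, of "\<Prod>l<i. a - of_nat l"]
      have "(F a i has_field_derivative F a (Suc i) z) (at z)"
        by (simp add: F_def algebra_simps)
      then show "(F a i has_field_derivative F a (Suc i) z) (at z within S)"
        by (rule has_field_derivative_at_within)
    next
      fix z assume z: "z \<in> S"
      obtain t where t: "z = of_real t" "0 \<le> t" "t \<le> 1" using S[OF z] by blast
      have "norm ((1 + z) powr (a - of_nat (Suc m))) = (1 + t) powr (Re a - real (Suc m))"
        using t norm_powr_real_powr[of "1 + z" "a - of_nat (Suc m)"] by simp
      also have "\<dots> \<le> (1 + t) powr (\<bar>K\<bar> + real (Suc m))"
        using t abs_Re_le_cmod[of a] a by (intro powr_mono) auto
      also have "\<dots> \<le> 2 powr (\<bar>K\<bar> + real (Suc m))"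
        using t by (intro powr_mono2) auto
      finally have p: "norm ((1 + z) powr (a - of_nat (Suc m))) \<le> 2 powr (\<bar>K\<bar> + real (Suc m))" .
      have q: "norm (\<Prod>l<Suc m. a - of_nat l) \<le> (\<Prod>l<Suc m. \<bar>K\<bar> + real l)"
        unfolding prod_norm[symmetric]
      proof (rule prod_mono, safe)
        fix l
        show "norm (a - of_nat l) \<le> \<bar>K\<bar> + real l"
          using norm_triangle_ineq4[of a "of_nat l"] a by simp
      qed auto
      have "norm (F a (Suc m) z) = norm (\<Prod>l<Suc m. a - of_nat l) * norm ((1 + z) powr (a - of_nat (Suc m)))"
        unfolding F_def by (rule norm_mult)
      also have "\<dots> \<le> (\<Prod>l<Suc m. \<bar>K\<bar> + real l) * 2 powr (\<bar>K\<bar> + real (Suc m))"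
        by (intro mult_mono p q prod_nonneg) auto
      finally show "norm (F a (Suc m) z) \<le> C * fact m" unfolding C_def by simp
    qed
    have g: "F a i 0 * (of_real x - 0) ^ i / fact i = (a gchoose i) * of_real x ^ i" for i
      by (simp add: F_def gbinomial_prod_rev atLeast0LessThan)
    show ?thesis using 1 unfolding g using x by (simp add: F_def)
  qed
  ultimately show ?thesis using that by blast
qed

definition zeta_rem_term :: "nat \<Rightarrow> nat \<Rightarrow> complex \<Rightarrow> complex" where
  "zeta_rem_term m n s = of_nat (n + 1) powr (1 - s) -
     (\<Sum>i\<le>m. ((1 - s) gchoose i) * of_nat n powr (1 - s - of_nat i))"

lemma zeta_rem_term_bound:
  fixes K :: real and m :: nat
  obtains C where "C \<ge> 0"
    "\<And>s n. norm (1 - s) \<le> K \<Longrightarrow> n > 0 \<Longrightarrow>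
       norm (zeta_rem_term m n s) \<le> C * real n powr (- Re s - real m)"
proof -
  obtain C where C: "C \<ge> 0"
    "\<And>a x. norm (a::complex) \<le> K \<Longrightarrow> 0 \<le> x \<Longrightarrow> x \<le> 1 \<Longrightarrow>
       norm ((1 + of_real x) powr a - (\<Sum>i\<le>m. (a gchoose i) * of_real x ^ i)) \<le> C * x ^ Suc m"
    using powr_Taylor_bound[where K = K and m = m] by blast
  have "norm (zeta_rem_term m n s) \<le> C * real n powr (- Re s - real m)"
    if s: "norm (1 - s) \<le> K" and n: "n > 0" for s n
  proof -
    define x where "x = 1 / real n"
    have x: "0 \<le> x" "x \<le> 1" using n by (auto simp: x_def)
    have e: "of_nat (n + 1) = complex_of_real (real n) * complex_of_real (1 + x)"
      using n by (simp add: x_def field_simps)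
    have 1: "of_nat (n + 1) powr (1 - s) = of_nat n powr (1 - s) * (1 + of_real x) powr (1 - s)"
      unfolding e using x by (subst powr_times_real) auto
    have 2: "of_nat n powr (1 - s - of_nat i) = of_nat n powr (1 - s) * of_real x ^ i" for i
      using n by (simp add: powr_diff powr_nat' x_def divide_inverse power_inverse)
    have "zeta_rem_term m n s = of_nat n powr (1 - s) *
       ((1 + of_real x) powr (1 - s) - (\<Sum>i\<le>m. ((1 - s) gchoose i) * of_real x ^ i))"
      unfolding zeta_rem_term_def 1 2 by (simp add: algebra_simps sum_distrib_left)
    then have "norm (zeta_rem_term m n s) = norm (complex_of_nat n powr (1 - s)) *
       norm ((1 + of_real x) powr (1 - s) - (\<Sum>i\<le>m. ((1 - s) gchoose i) * of_real x ^ i))"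
      by (simp only: norm_mult)
    also have "\<dots> \<le> norm (complex_of_nat n powr (1 - s)) * (C * x ^ Suc m)"
      by (intro mult_left_mono C(2) s x) auto
    also have "norm (complex_of_nat n powr (1 - s)) = real n powr (1 - Re s)"
      using n by (subst norm_powr_real_powr) auto
    also have "x ^ Suc m = real n powr (- real (Suc m))"
      using n by (simp only: x_def powr_minus powr_realpow of_nat_0_less_iff power_one_over inverse_eq_divide)
    also have "real n powr (1 - Re s) * (C * real n powr (- real (Suc m))) = C * real n powr (- Re s - real m)"
      by (simp add: powr_add[symmetric] algebra_simps)
    finally show ?thesis .
  qed
  with C(1) show ?thesis using that by blast
qed

lemma zeta_rem_uniform:
  assumes "Re s > 1 - real m"
  obtains d where "d > 0" "cball s d \<subseteq> {s. Re s > 1 - real m}"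
    "uniform_limit (cball s d) (\<lambda>N s. \<Sum>n<N. zeta_rem_term m (Suc n) s)
       (\<lambda>s. \<Sum>n. zeta_rem_term m (Suc n) s) sequentially"
    "summable (\<lambda>n. zeta_rem_term m (Suc n) s)"
proof -
  define d where "d = (Re s - (1 - real m)) / 2"
  have d: "d > 0" using assms by (simp add: d_def)
  have re: "Re z \<ge> 1 - real m + d" if "z \<in> cball s d" for z
  proof -
    have "\<bar>Re s - Re z\<bar> \<le> d" using that abs_Re_le_cmod[of "s - z"] by (simp add: dist_norm)
    then show ?thesis by (simp add: d_def field_simps abs_if split: if_splits)
  qed
  obtain C where C: "C \<ge> 0"
    "\<And>z n. norm (1 - z) \<le> norm (1 - s) + d \<Longrightarrow> n > 0 \<Longrightarrow>
       norm (zeta_rem_term m n z) \<le> C * real n powr (- Re z - real m)"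
    using zeta_rem_term_bound[where K = "norm (1 - s) + d" and m = m] by blast
  have bd: "norm (zeta_rem_term m (Suc n) z) \<le> C * real (Suc n) powr (- 1 - d)"
    if z: "z \<in> cball s d" for n z
  proof -
    have "norm (1 - z) \<le> norm (1 - s) + d"
      using norm_triangle_ineq[of "1 - s" "s - z"] z by (simp add: dist_norm)
    then have "norm (zeta_rem_term m (Suc n) z) \<le> C * real (Suc n) powr (- Re z - real m)"
      by (intro C(2)) auto
    also have "\<dots> \<le> C * real (Suc n) powr (- 1 - d)"
      using re[OF z] C(1) by (intro mult_left_mono powr_mono) auto
    finally show ?thesis .
  qed
  have sm: "summable (\<lambda>n. C * real (Suc n) powr (- 1 - d))"
    using d summable_real_powr_iff[of "- 1 - d"]
    by (intro summable_mult) (subst summable_Suc_iff, simp)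
  have "cball s d \<subseteq> {s. Re s > 1 - real m}" using re d by fastforce
  moreover have "uniform_limit (cball s d) (\<lambda>N s. \<Sum>n<N. zeta_rem_term m (Suc n) s)
       (\<lambda>s. \<Sum>n. zeta_rem_term m (Suc n) s) sequentially"
    by (rule Weierstrass_m_test[OF bd sm])
  moreover have "summable (\<lambda>n. zeta_rem_term m (Suc n) s)"
    using d by (intro summable_comparison_test[OF _ sm] exI[of _ 0] allI impI bd) auto
  ultimately show ?thesis using d that by blast
qed

lemma holomorphic_gbinomial:
  assumes "f holomorphic_on S"
  shows "(\<lambda>s. (f s) gchoose i) holomorphic_on S"
  unfolding gbinomial_prod_rev by (intro holomorphic_intros assms) auto

lemma open_Re_gt: "open {s. Re s > c}"
  using open_halfspace_Re_gt[of c] by simp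

lemma holomorphic_zeta_rem:
  "(\<lambda>s. \<Sum>n. zeta_rem_term m (Suc n) s) holomorphic_on {s. Re s > 1 - real m}"
proof (rule holomorphic_uniform_sequence)
  show "open {s. Re s > 1 - real m}" by (rule open_Re_gt)
  show "(\<lambda>s. \<Sum>n<N. zeta_rem_term m (Suc n) s) holomorphic_on {s. Re s > 1 - real m}" for N
    unfolding zeta_rem_term_def
    by (intro holomorphic_intros holomorphic_gbinomial)
  show "\<exists>d>0. cball s d \<subseteq> {s. Re s > 1 - real m} \<and>
      uniform_limit (cball s d) (\<lambda>N s. \<Sum>n<N. zeta_rem_term m (Suc n) s)
       (\<lambda>s. \<Sum>n. zeta_rem_term m (Suc n) s) sequentially"
    if "s \<in> {s. Re s > 1 - real m}" for s
    using zeta_rem_uniform[of m s] that by (metis mem_Collect_eq)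
qed

definition zeta_series :: "complex \<Rightarrow> complex" where
  "zeta_series s = (\<Sum>n. of_nat (Suc n) powr (- s))"

lemma zeta_series_sums:
  assumes "Re s > 1"
  shows "(\<lambda>n. of_nat (Suc n) powr (- s)) sums zeta_series s"
  unfolding zeta_series_def
proof (rule summable_sums, rule summable_norm_cancel)
  have "norm (of_nat (Suc n) powr (- s)) = real (Suc n) powr (- Re s)" for n
    by (subst norm_powr_real_powr) auto
  moreover have "summable (\<lambda>n. real (Suc n) powr (- Re s))"
    using assms summable_real_powr_iff[of "- Re s"] by (subst summable_Suc_iff) simp
  ultimately show "summable (\<lambda>n. norm (of_nat (Suc n) powr (- s)))" by (simp only:)
qed

lemma zeta_series_recurrence:
  assumes s: "Re s > 1"
  shows "(s - 1) * zeta_series s =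
     1 - (\<Sum>i=2..Suc k. ((1 - s) gchoose (i - 1)) / of_nat i * ((s + of_nat i - 2) * zeta_series (s + of_nat i - 1)))
       + (\<Sum>n. zeta_rem_term (Suc k) (Suc n) s)"
proof -
  define R where "R = (\<Sum>n. zeta_rem_term (Suc k) (Suc n) s)"
  define G where "G = (\<lambda>i. (1 - s) gchoose i)"
  have "Re s > 1 - real (Suc k)" using s by simp
  then have "summable (\<lambda>n. zeta_rem_term (Suc k) (Suc n) s)"
    by (rule zeta_rem_uniform)
  then have R: "(\<lambda>n. zeta_rem_term (Suc k) (Suc n) s) sums R"
    unfolding R_def by (rule summable_sums)
  have Z: "(\<lambda>n. G i * of_nat (Suc n) powr (1 - s - of_nat i)) sums (G i * zeta_series (s + of_nat i - 1))"
    if "i \<in> {1..Suc k}" for i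
  proof (rule sums_mult)
    have "1 - s - of_nat i = - (s + of_nat i - 1)" by simp
    moreover have "Re (s + of_nat i - 1) > 1" using s that by auto
    ultimately show "(\<lambda>n. of_nat (Suc n) powr (1 - s - of_nat i)) sums zeta_series (s + of_nat i - 1)"
      using zeta_series_sums by metis
  qed
  have A: "(\<lambda>n. (\<Sum>i=1..Suc k. G i * of_nat (Suc n) powr (1 - s - of_nat i)) + zeta_rem_term (Suc k) (Suc n) s)
       sums ((\<Sum>i=1..Suc k. G i * zeta_series (s + of_nat i - 1)) + R)"
    by (intro sums_add sums_sum R Z)
  have B: "(\<Sum>i=1..Suc k. G i * of_nat (Suc n) powr (1 - s - of_nat i)) + zeta_rem_term (Suc k) (Suc n) s
       = of_nat (Suc (Suc n)) powr (1 - s) - of_nat (Suc n) powr (1 - s)" for n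
  proof -
    have "{..Suc k} = insert 0 {1..Suc k}" by auto
    then show ?thesis unfolding zeta_rem_term_def G_def by simp
  qed
  have lim: "(\<lambda>n. of_nat (Suc n) powr (1 - s) :: complex) \<longlonglongrightarrow> 0"
  proof (rule tendsto_norm_zero_cancel)
    have "norm (complex_of_nat (Suc n) powr (1 - s)) = real (Suc n) powr (- (Re s - 1))" for n
      by (subst norm_powr_real_powr) auto
    moreover have "(\<lambda>n. real (Suc n) powr (- (Re s - 1))) \<longlonglongrightarrow> 0"
      using s by (intro tendsto_neg_powr filterlim_compose[OF filterlim_real_sequentially filterlim_Suc]) auto
    ultimately show "(\<lambda>n. norm (complex_of_nat (Suc n) powr (1 - s))) \<longlonglongrightarrow> 0" by (simp only:)
  qed
  have "(\<lambda>n. of_nat (Suc (Suc n)) powr (1 - s) - of_nat (Suc n) powr (1 - s)) sums (0 - of_nat (Suc 0) powr (1 - s) :: complex)"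
    by (rule telescope_sums[OF lim])
  with A have E: "(\<Sum>i=1..Suc k. G i * zeta_series (s + of_nat i - 1)) + R = - 1"
    unfolding B using sums_unique2 by fastforce
  have "{1..Suc k} = insert 1 {2..Suc k}" by auto
  then have "(\<Sum>i=1..Suc k. G i * zeta_series (s + of_nat i - 1)) =
      (1 - s) * zeta_series s + (\<Sum>i=2..Suc k. G i * zeta_series (s + of_nat i - 1))"
    by (simp add: G_def)
  moreover have "(\<Sum>i=2..Suc k. G i * zeta_series (s + of_nat i - 1)) =
     - (\<Sum>i=2..Suc k. G (i - 1) / of_nat i * ((s + of_nat i - 2) * zeta_series (s + of_nat i - 1)))"
    unfolding sum_negf[symmetric]
  proof (rule sum.cong[OF refl])
    fix i assume "i \<in> {2..Suc k}"
    then obtain j where j: "i = Suc j" by (cases i) auto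
    have "of_nat (Suc j) * G (Suc j) = (1 - s - of_nat j) * G j"
      using gbinomial_absorption'[of "Suc j" "1 - s"] gbinomial_mult_1[of "1 - s" j]
      unfolding G_def by (simp add: algebra_simps)
    then have "G (Suc j) = (1 - s - of_nat j) * G j / of_nat (Suc j)"
      by (metis nonzero_mult_div_cancel_left of_nat_eq_0_iff nat.distinct(1))
    then show "G i * zeta_series (s + of_nat i - 1) =
      - (G (i - 1) / of_nat i * ((s + of_nat i - 2) * zeta_series (s + of_nat i - 1)))"
      unfolding j by simp (simp add: algebra_simps minus_divide_left)
  qed
  ultimately have "(1 - s) * zeta_series s -
      (\<Sum>i=2..Suc k. G (i - 1) / of_nat i * ((s + of_nat i - 2) * zeta_series (s + of_nat i - 1))) + R = - 1"
    using E by simp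
  then show ?thesis unfolding G_def[symmetric] R_def[symmetric]
    by (simp del: sum.cl_ivl_Suc add: left_diff_distrib algebra_simps eq_neg_iff_add_eq_0)
qed

lemma zeta_continuation_step:
  "\<exists>g. g holomorphic_on {s. Re s > - real k} \<and> (\<forall>s. Re s > 1 \<longrightarrow> g s = (s - 1) * zeta_series s)"
proof (induction k)
  case 0
  show ?case
  proof (intro exI conjI allI impI)
    show "(\<lambda>s. 1 + (\<Sum>n. zeta_rem_term (Suc 0) (Suc n) s)) holomorphic_on {s. Re s > - real 0}"
      using holomorphic_zeta_rem[of "Suc 0"] by (intro holomorphic_intros) simp
    show "1 + (\<Sum>n. zeta_rem_term (Suc 0) (Suc n) s) = (s - 1) * zeta_series s" if "Re s > 1" for s
      using zeta_series_recurrence[OF that, of 0] by simp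
  qed
next
  case (Suc k)
  then obtain g where g: "g holomorphic_on {s. Re s > - real k}"
    "\<And>s. Re s > 1 \<Longrightarrow> g s = (s - 1) * zeta_series s" by blast
  define h where "h = (\<lambda>s. 1 - (\<Sum>i=2..Suc (Suc k). ((1 - s) gchoose (i - 1)) / of_nat i * g (s + of_nat i - 1))
       + (\<Sum>n. zeta_rem_term (Suc (Suc k)) (Suc n) s))"
  show ?case
  proof (intro exI conjI allI impI)
    have "(\<lambda>s. g (s + of_nat i - 1)) holomorphic_on {s. Re s > - real (Suc k)}"
      if "i \<in> {2..Suc (Suc k)}" for i
      using that
      by (intro holomorphic_on_compose_gen[OF _ g(1), unfolded o_def] holomorphic_intros) auto
    then show "h holomorphic_on {s. Re s > - real (Suc k)}"
      unfolding h_def using holomorphic_zeta_rem[of "Suc (Suc k)"]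
      by (intro holomorphic_intros holomorphic_gbinomial) auto
    show "h s = (s - 1) * zeta_series s" if "Re s > 1" for s
    proof -
      have "g (s + of_nat i - 1) = (s + of_nat i - 2) * zeta_series (s + of_nat i - 1)"
        if "i \<in> {2..Suc (Suc k)}" for i
        using \<open>Re s > 1\<close> that by (subst g(2)) auto
      then show ?thesis
        unfolding h_def zeta_series_recurrence[OF that, of "Suc k"] by simp
    qed
  qed
qed

lemma holomorphic_eq_right_half_plane:
  assumes "f holomorphic_on S" "g holomorphic_on S" "open S" "connected S"
    and "{s. Re s > 1} \<subseteq> S" "\<And>s. Re s > 1 \<Longrightarrow> f s = g s" "z \<in> S"
  shows "f z = g z"
proof -
  have "f z - g z = 0"
  proof (rule analytic_continuation_open[of "{s. Re s > 1}" S "\<lambda>s. f s - g s" "\<lambda>_. 0"])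
    show "{s. Re s > 1} \<noteq> {}" by (auto intro!: exI[of _ 2])
  qed (use assms open_Re_gt[of 1] in \<open>auto intro!: holomorphic_intros\<close>)
  then show ?thesis by simp
qed

lemma zeta_continuation:
  "\<exists>g. g holomorphic_on UNIV \<and> (\<forall>s. Re s > 1 \<longrightarrow> g s = (s - 1) * zeta_series s)"
proof -
  obtain g where g: "\<And>k. g k holomorphic_on {s. Re s > - real k}"
    "\<And>k s. Re s > 1 \<Longrightarrow> g k s = (s - 1) * zeta_series s"
    using zeta_continuation_step by metis
  have conn: "connected {s. Re s > - real k}" for k
    using convex_halfspace_Re_gt[of "- real k"] by (simp add: convex_connected)
  have agree: "g j s = g k s" if "j \<le> k" "Re s > - real j" for j k s
  proof (rule holomorphic_eq_right_half_plane[of "g j" "{s. Re s > - real j}" "g k"])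
    show "g k holomorphic_on {s. Re s > - real j}"
      by (rule holomorphic_on_subset[OF g(1)[of k]]) (use that in auto)
  qed (use that g open_Re_gt conn in auto)
  define G where "G = (\<lambda>s. g (nat \<lceil>\<bar>Re s\<bar> + 1\<rceil>) s)"
  have Re_gt: "Re s > - real (nat \<lceil>\<bar>Re s\<bar> + 1\<rceil>)" for s by linarith
  have G: "G s = g k s" if "Re s > - real k" for s k
    unfolding G_def using agree[OF _ that] agree[OF _ Re_gt[of s]] that
    by (metis nat_le_linear)
  have "G holomorphic_on (\<Union>k. {s. Re s > - real k})"
  proof (rule holomorphic_on_UN_open)
    show "G holomorphic_on {s. Re s > - real k}" for k
      using g(1)[of k] G by (rule_tac holomorphic_transform) auto
  qed (rule open_Re_gt)
  moreover have "(\<Union>k. {s. Re s > - real k}) = UNIV" using Re_gt by blast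
  ultimately have "G holomorphic_on UNIV" by simp
  moreover have "G s = (s - 1) * zeta_series s" if "Re s > 1" for s
    unfolding G_def by (rule g(2)[OF that])
  ultimately show ?thesis by blast
qed

lemma zeta_ex1: "\<exists>!f. is_zeta f"
proof -
  obtain g where g: "g holomorphic_on UNIV" "\<And>s. Re s > 1 \<Longrightarrow> g s = (s - 1) * zeta_series s"
    using zeta_continuation by blast
  define f where "f = (\<lambda>s. if s = 1 then 0 else g s / (s - 1))"
  have "(\<lambda>s. g s / (s - 1)) holomorphic_on (- {1})"
    by (intro holomorphic_intros holomorphic_on_subset[OF g(1)]) auto
  then have "f holomorphic_on (- {1})"
    by (rule holomorphic_transform) (auto simp: f_def)
  then have "is_zeta f"
    unfolding is_zeta_def using g(2) by (auto simp: f_def zeta_series_def)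
  moreover have "f1 = f2" if "is_zeta f1" "is_zeta f2" for f1 f2
  proof
    fix z show "f1 z = f2 z"
    proof (cases "z = 1")
      case False
      show ?thesis
      proof (rule holomorphic_eq_right_half_plane[of f1 "- {1}" f2])
        show "connected (- {1 :: complex})"
          by (rule connected_punctured_universe) simp
      qed (use that False in \<open>auto simp: is_zeta_def\<close>)
    qed (use that in \<open>auto simp: is_zeta_def\<close>)
  qed
  ultimately show ?thesis by blast
qed

lemma is_zeta_zeta: "is_zeta zeta"
  unfolding zeta_def by (rule theI'[OF zeta_ex1])


section \<open>The regulated area integral\<close>

text \<open>
  A listing \<open>(\<rho>\<^sub>k)\<close> with \<open>k \<ge> 1\<close> of the nontrivial zeros, in any order; repetitions are allowed,
  so zeros may be listed with or without multiplicity. The value \<open>\<rho> 0\<close> is irrelevant.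
\<close>

definition lists_nontrivial_zeros :: "(nat \<Rightarrow> complex) \<Rightarrow> bool" where
  "lists_nontrivial_zeros \<rho> \<longleftrightarrow> \<rho> ` {1..} = nontrivial_zeros"

definition disc_radius :: "real \<Rightarrow> real \<Rightarrow> nat \<Rightarrow> real" where
  "disc_radius \<alpha> N0 k = (real k + N0) powr (- \<alpha>)"

definition reg_domain :: "(nat \<Rightarrow> complex) \<Rightarrow> real \<Rightarrow> real \<Rightarrow> real \<Rightarrow> complex set" where
  "reg_domain \<rho> \<alpha> N0 R =
     {s. Re s \<in> {0..1} \<and> \<bar>Im s\<bar> \<le> R} - (\<Union>k\<in>{1..}. ball (\<rho> k) (disc_radius \<alpha> N0 k))"

text \<open>
  The integrand is nonnegative, so the integral is taken in \<open>[0, \<infinity>]\<close>. The convention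
  \<open>1 / 0 = 0\<close> only affects a null set: the line \<open>Re s = 1/2\<close>, the pole \<open>s = 1\<close> and zeros of zeta.
\<close>

definition reg_area_integral ::
    "(nat \<Rightarrow> complex) \<Rightarrow> real \<Rightarrow> real \<Rightarrow> real \<Rightarrow> real \<Rightarrow> real \<Rightarrow> ennreal" where
  "reg_area_integral \<rho> \<alpha> N0 lam p R =
     ennreal (1 / (2 * R)) *
     (\<integral>\<^sup>+ s \<in> reg_domain \<rho> \<alpha> N0 R.
        ennreal (1 / (norm (zeta s) powr lam * \<bar>Re s - 1/2\<bar> powr p)) \<partial>lborel)"

end

theory Submission
  imports Defs "HOL-Probability.Probability" "HOL-Computational_Algebra.Squarefree"
    "HOL-Analysis.Kronecker_Approximation_Theorem"
begin

text \<open>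
  The area integral diverges because of the part of the strip just to the right of the critical
  line. For \<open>1/2 < x < 1\<close> the mean of \<open>1 / |zeta|\<^sup>2\<close> on the line \<open>Re s = x\<close> is heuristically
  \<open>\<Sum> \<mu>(n)\<^sup>2 n\<^sup>-\<^sup>2\<^sup>x = zeta(2x) / zeta(4x)\<close>, which is of size \<open>1 / (2x - 1)\<close>, and this is not integrable
  at \<open>x = 1/2\<close>. The discs do not spoil this: since \<open>\<alpha> > 1\<close> the radii are summable, so the
  imaginary parts met by some disc form a set \<open>E\<close> of finite measure, which is negligible
  in a mean over \<open>[0, T]\<close>. A lower bound of order \<open>1 / (2x - 1)\<close> on each vertical line
  (\<open>zeta_negative_moment_large\<close>), Fatou's lemma in \<open>x\<close> and Tonelli's theorem then give the claim.

  The bound on a line uses a mollifier. For a finite set \<open>S\<close> of primes put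
  \<open>M(s) = \<Prod>p\<in>S. (1 - p\<^sup>-\<^sup>s)\<close>. Expanding the square of \<open>1 / |zeta| - k |zeta| |M|\<^sup>2\<close> gives
  \<open>1 / |zeta|\<^sup>2 \<ge> 2 k |M|\<^sup>2 - k\<^sup>2 |zeta M\<^sup>2|\<^sup>2\<close> wherever zeta does not vanish. The mean of \<open>|M|\<^sup>2\<close> is
  \<open>V = \<Sum> d\<^sup>-\<^sup>2\<^sup>x\<close> over the products \<open>d\<close> of distinct primes in \<open>S\<close>
  (\<open>mean_square_euler_product\<close>), and the mean of \<open>|zeta M\<^sup>2|\<^sup>2\<close> is at most a constant times \<open>V\<close> once
  \<open>S\<close> contains all primes up to a large bound, because the Dirichlet coefficients of \<open>zeta M\<^sup>2\<close> are
  \<open>0\<close>, \<open>1\<close> or \<open>-1\<close> and vanish at all \<open>n\<close> divisible by \<open>p\<^sup>2\<close> for some \<open>p \<in> S\<close>. A suitable absolute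
  constant \<open>k\<close> leaves a positive multiple of \<open>V\<close>, and \<open>V\<close> is at least of order \<open>1 / (2x - 1)\<close>
  by \<open>squarefree_sum_large\<close>.

  The upper bound for the mean square of \<open>zeta M\<^sup>2\<close> inside the critical strip
  (\<open>mean_square_upper_bound\<close>) comes from Fourier analysis. If \<open>r(u)\<close> is the error of the summatory
  function of the coefficients at \<open>e\<^sup>u\<close>, then \<open>Z(s) / s\<close> is the two-sided Laplace transform of \<open>r\<close> for
  \<open>0 < Re s < 1\<close>. Replacing \<open>r(u)\<close> by \<open>r(u + \<eta>) - r(u)\<close> multiplies the transform by \<open>e\<^sup>\<eta>\<^sup>s - 1\<close>, which
  is comparable to \<open>\<eta> s\<close> for \<open>|s| \<le> 1 / (4 \<eta>)\<close> and so removes the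
  denominator. Bessel's inequality reduces the problem to the mean square of sums over very short intervals:
  below \<open>1 / (4 \<eta>)\<close> these contain at most one integer and give the diagonal sum, and above
  that the trivial bound suffices for \<open>x > 1/2\<close>.
\<close>

section \<open>Sums over numbers free of small prime squares\<close>

lemma prod_primes_dvd:
  fixes n :: nat
  assumes "finite Y" "\<And>p. p \<in> Y \<Longrightarrow> prime p \<and> p dvd n"
  shows "\<Prod>Y dvd n"
  using assms
proof (induction Y rule: finite_induct)
  case (insert p Y)
  have "coprime p (\<Prod>Y)"
    using insert by (intro prod_coprime_right) (auto intro!: primes_coprime)
  then show ?case using insert by (simp add: divides_mult)
qed simp

text \<open>
  Such an \<open>n\<close> factors uniquely as the product of the primes of \<open>S\<close> that divide it and a cofactor
  not divisible by any prime of \<open>S\<close>.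
\<close>

lemma sum_free_of_prime_squares_le:
  fixes x :: real
  assumes S: "finite S" "\<And>p. p \<in> S \<Longrightarrow> prime p"
  shows "(\<Sum>n | n \<in> {1..N} \<and> (\<forall>p\<in>S. \<not> p\<^sup>2 dvd n). real n powr (- x)) \<le>
    (\<Sum>X\<in>Pow S. real (\<Prod>X) powr (- x)) * (\<Sum>m | m \<in> {1..N} \<and> (\<forall>p\<in>S. \<not> p dvd m). real m powr (- x))"
proof -
  define A where "A = {n. n \<in> {1..N} \<and> (\<forall>p\<in>S. \<not> p\<^sup>2 dvd n)}"
  define M where "M = {m. m \<in> {1..N} \<and> (\<forall>p\<in>S. \<not> p dvd m)}"
  define X where "X = (\<lambda>n. {p \<in> S. p dvd n})"
  define g where "g = (\<lambda>n. (X n, n div \<Prod>(X n)))"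
  have dv: "\<Prod>(X n) dvd n" for n
    by (rule prod_primes_dvd) (use S in \<open>auto simp: X_def\<close>)
  have gM: "g n \<in> Pow S \<times> M" if n: "n \<in> A" for n
  proof -
    define m where "m = n div \<Prod>(X n)"
    have nm: "n = \<Prod>(X n) * m" using dv[of n] by (simp add: m_def)
    have n0: "n > 0" "n \<le> N" using n by (auto simp: A_def)
    have m0: "m > 0" using nm n0 by (cases m) auto
    have "m \<le> n" unfolding m_def by simp
    have "\<not> p dvd m" if p: "p \<in> S" for p
    proof
      assume pm: "p dvd m"
      then have "p dvd n" using nm by (metis dvd_mult)
      then have "p dvd \<Prod>(X n)" using S(1) p by (intro dvd_prodI) (auto simp: X_def)
      then have "p * p dvd n" using pm nm by (metis mult_dvd_mono)
      then show False using n p by (auto simp: A_def power2_eq_square)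
    qed
    then have "m \<in> M" using m0 n0 \<open>m \<le> n\<close> by (simp add: M_def)
    then show ?thesis unfolding g_def m_def by (auto simp: X_def)
  qed
  have gv: "real n powr (- x) = real (\<Prod>(fst (g n))) powr (- x) * real (snd (g n)) powr (- x)" for n
  proof -
    have "real n = real (\<Prod>(X n)) * real (n div \<Prod>(X n))"
      unfolding of_nat_mult[symmetric] using dv[of n] by simp
    then show ?thesis by (simp add: g_def powr_mult del: of_nat_prod)
  qed
  have inj: "inj_on g A"
  proof (rule inj_onI)
    fix n n' assume "g n = g n'"
    then have "X n = X n'" "n div \<Prod>(X n) = n' div \<Prod>(X n')" by (auto simp: g_def)
    then show "n = n'" using dv[of n] dv[of n'] by (metis dvd_mult_div_cancel)
  qed
  have "(\<Sum>n\<in>A. real n powr (- x)) = (\<Sum>(Y, m)\<in>g ` A. real (\<Prod>Y) powr (- x) * real m powr (- x))"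
    unfolding sum.reindex[OF inj] o_def by (intro sum.cong refl) (subst gv, simp add: case_prod_unfold)
  also have "\<dots> \<le> (\<Sum>(Y, m)\<in>Pow S \<times> M. real (\<Prod>Y) powr (- x) * real m powr (- x))"
  proof (rule sum_mono2)
    show "g ` A \<subseteq> Pow S \<times> M" using gM by blast
  qed (use S(1) in \<open>auto simp: M_def\<close>)
  also have "\<dots> = (\<Sum>X\<in>Pow S. real (\<Prod>X) powr (- x)) * (\<Sum>m\<in>M. real m powr (- x))"
    by (simp add: sum_product sum.cartesian_product)
  finally show ?thesis unfolding A_def M_def .
qed

lemma prod_prime_factors_squarefree_part:
  fixes n :: nat
  assumes "n > 0"
  shows "\<Prod>(prime_factors (squarefree_part n)) = squarefree_part n"
proof -
  have n0: "squarefree_part n \<noteq> 0" by simp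
  have "p ^ multiplicity p (squarefree_part n) = p" if "p \<in> prime_factors (squarefree_part n)" for p
  proof -
    have "multiplicity p (squarefree_part n) > 0" "prime p"
      using that by (auto simp: prime_factors_multiplicity)
    moreover have "multiplicity p (squarefree_part n) = multiplicity p n mod 2"
      by (rule prime_multiplicity_squarefree_part) fact
    ultimately have "multiplicity p (squarefree_part n) = 1" by linarith
    then show ?thesis by simp
  qed
  then have "\<Prod>(prime_factors (squarefree_part n)) =
      (\<Prod>p\<in>prime_factors (squarefree_part n). p ^ multiplicity p (squarefree_part n))"
    by (intro prod.cong) auto
  also have "\<dots> = squarefree_part n"
    using prod_prime_factors[OF n0] by simp
  finally show ?thesis .
qed

lemma sum_inverse_squares_le_2: "(\<Sum>k=1..P. 1 / (real k)\<^sup>2) \<le> 2"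
proof -
  have "(\<Sum>k=1..Suc P. 1 / (real k)\<^sup>2) \<le> 2 - 1 / real (Suc P)" for P
  proof (induction P)
    case (Suc P)
    have "1 / (real (Suc (Suc P)))\<^sup>2 \<le> 1 / real (Suc P) - 1 / real (Suc (Suc P))"
      by (simp add: divide_simps power2_eq_square)
    with Suc show ?case by simp
  qed simp
  then have "(\<Sum>k=1..Suc P. 1 / (real k)\<^sup>2) \<le> 2" by (rule order_trans) simp
  moreover have "(\<Sum>k=1..P. 1 / (real k)\<^sup>2) \<le> (\<Sum>k=1..Suc P. 1 / (real k)\<^sup>2)"
    by (rule sum_mono2) auto
  ultimately show ?thesis by linarith
qed

text \<open>
  Writing \<open>n = d k\<^sup>2\<close> with \<open>d\<close> squarefree costs at most the factor \<open>\<Sum> k\<^sup>-\<^sup>2\<^sup>x \<le> 2\<close>.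
\<close>

lemma sum_le_squarefree_sum:
  fixes x :: real and P :: nat
  assumes x: "x \<ge> 1"
  defines "S \<equiv> {p. prime p \<and> p \<le> P}"
  shows "(\<Sum>n=1..P. real n powr (- x)) \<le> 2 * (\<Sum>X\<in>Pow S. real (\<Prod>X) powr (- x))"
proof -
  have S: "finite S" unfolding S_def by (rule finite_subset[of _ "{..P}"]) auto
  define g where "g = (\<lambda>n::nat. (prime_factors (squarefree_part n), square_part n))"
  have split_n: "n = \<Prod>(fst (g n)) * (snd (g n))\<^sup>2" if "n > 0" for n
    using squarefree_decompose[of n] prod_prime_factors_squarefree_part[OF that] by (simp add: g_def)
  have inj: "inj_on g {1..P}"
  proof (rule inj_onI)
    fix n n' assume "n \<in> {1..P}" "n' \<in> {1..P}" "g n = g n'"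
    then show "n = n'" using split_n[of n] split_n[of n'] by simp
  qed
  have gr: "g n \<in> Pow S \<times> {1..P}" if n: "n \<in> {1..P}" for n
  proof -
    have dv: "squarefree_part n dvd n" "square_part n dvd n"
      by (subst (2) squarefree_decompose[of n], simp)
         (subst (2) squarefree_decompose[of n], simp add: power2_eq_square)
    have le: "d \<le> P" if "d dvd n" for d using dvd_imp_le[OF that] n by auto
    have "fst (g n) \<subseteq> S"
      using dv le by (auto simp: g_def S_def in_prime_factors_iff intro: dvd_trans)
    moreover have "square_part n > 0" using n by (intro Nat.gr0I) simp
    ultimately show ?thesis using le dv by (simp add: g_def Suc_le_eq)
  qed
  have gv: "real n powr (- x) = real (\<Prod>(fst (g n))) powr (- x) * real (snd (g n)) powr (- 2 * x)"
    if n: "n \<in> {1..P}" for n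
  proof -
    have k: "real (snd (g n)) > 0" using gr[OF n] by (cases "g n") auto
    have "n = \<Prod>(fst (g n)) * (snd (g n))\<^sup>2" using n by (intro split_n) auto
    then have "real n = real (\<Prod>(fst (g n)) * (snd (g n))\<^sup>2)" by (rule arg_cong)
    also have "\<dots> = real (\<Prod>(fst (g n))) * (real (snd (g n)))\<^sup>2" by simp
    also have "(real (snd (g n)))\<^sup>2 = real (snd (g n)) powr 2" using k by simp
    finally show ?thesis by (simp add: powr_mult powr_powr del: of_nat_prod powr_numeral)
  qed
  have "(\<Sum>n=1..P. real n powr (- x)) = (\<Sum>(Y, k)\<in>g ` {1..P}. real (\<Prod>Y) powr (- x) * real k powr (- 2 * x))"
    unfolding sum.reindex[OF inj] o_def by (intro sum.cong refl) (subst gv, simp_all add: case_prod_unfold)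
  also have "\<dots> \<le> (\<Sum>(Y, k)\<in>Pow S \<times> {1..P}. real (\<Prod>Y) powr (- x) * real k powr (- 2 * x))"
  proof (rule sum_mono2)
    show "g ` {1..P} \<subseteq> Pow S \<times> {1..P}" using gr by blast
  qed (use S in auto)
  also have "\<dots> = (\<Sum>X\<in>Pow S. real (\<Prod>X) powr (- x)) * (\<Sum>k=1..P. real k powr (- 2 * x))"
    by (simp add: sum_product sum.cartesian_product)
  also have "\<dots> \<le> (\<Sum>X\<in>Pow S. real (\<Prod>X) powr (- x)) * (\<Sum>k=1..P. 1 / (real k)\<^sup>2)"
  proof (intro mult_left_mono sum_mono sum_nonneg)
    fix k assume "k \<in> {1..P}"
    then have "real k powr (- 2 * x) \<le> real k powr (- 2)" using x by (intro powr_mono) auto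
    then show "real k powr (- 2 * x) \<le> 1 / (real k)\<^sup>2"
      using \<open>k \<in> {1..P}\<close> by (simp add: powr_minus_divide)
  qed simp
  also have "\<dots> \<le> (\<Sum>X\<in>Pow S. real (\<Prod>X) powr (- x)) * 2"
    by (intro mult_left_mono sum_inverse_squares_le_2 sum_nonneg) simp
  finally show ?thesis by simp
qed

text \<open>
  Comparison with the integral of \<open>t\<^sup>-\<^sup>x\<close> from \<open>1\<close> to \<open>P + 1\<close>.
\<close>

lemma sum_powr_ge:
  fixes x :: real
  assumes x: "x > 1"
  shows "(1 - real (Suc P) powr (1 - x)) / (x - 1) \<le> (\<Sum>n=1..P. real n powr (- x))"
proof (induction P)
  case (Suc P)
  have "\<exists>z>real (Suc P). z < real (Suc (Suc P)) \<and> real (Suc (Suc P)) powr (1 - x) - real (Suc P) powr (1 - x) =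
     (real (Suc (Suc P)) - real (Suc P)) * ((1 - x) * z powr (- x))"
    by (rule MVT2) (auto intro!: derivative_eq_intros)
  then obtain z where z: "z > real (Suc P)"
    "real (Suc (Suc P)) powr (1 - x) - real (Suc P) powr (1 - x) = (1 - x) * z powr (- x)"
    by auto
  have "z powr (- x) \<le> real (Suc P) powr (- x)" using z x by (intro powr_mono2') auto
  then have "(x - 1) * z powr (- x) \<le> (x - 1) * real (Suc P) powr (- x)"
    using x by (intro mult_left_mono) auto
  then have "real (Suc P) powr (1 - x) - real (Suc (Suc P)) powr (1 - x) \<le> (x - 1) * real (Suc P) powr (- x)"
    using z(2) by (simp add: algebra_simps)
  then have "(real (Suc P) powr (1 - x) - real (Suc (Suc P)) powr (1 - x)) / (x - 1) \<le> real (Suc P) powr (- x)"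
    using x by (simp add: field_simps)
  with Suc have "(1 - real (Suc P) powr (1 - x)) / (x - 1) +
    (real (Suc P) powr (1 - x) - real (Suc (Suc P)) powr (1 - x)) / (x - 1) \<le> (\<Sum>n=1..Suc P. real n powr (- x))"
    by simp
  then show ?case by (simp add: add_divide_distrib[symmetric])
qed simp

text \<open>
  The set \<open>S\<close> consists of the primes up to a large \<open>P\<close>. A number without prime factor in \<open>S\<close> is
  \<open>1\<close> or exceeds \<open>P\<close>, so the factor contributed by the cofactors is at most \<open>1\<close> plus a small tail.
\<close>

lemma squarefree_sum_large:
  fixes x :: real
  assumes x: "x > 1"
  obtains S where "finite S" "\<And>p. p \<in> S \<Longrightarrow> prime p"
    "1 / (4 * (x - 1)) \<le> (\<Sum>X\<in>Pow S. real (\<Prod>X) powr (- x))"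
    "\<And>N. (\<Sum>n | n \<in> {1..N} \<and> (\<forall>p\<in>S. \<not> p\<^sup>2 dvd n). real n powr (- x))
        \<le> 2 * (\<Sum>X\<in>Pow S. real (\<Prod>X) powr (- x))"
proof -
  have sm: "summable (\<lambda>n. real n powr (- x))" using x by (simp add: summable_real_powr_iff)
  have "\<exists>N. \<forall>n\<ge>N. norm (\<Sum>i. real (i + n) powr (- x)) < 1"
    by (rule suminf_exist_split[OF _ sm]) simp
  then obtain N0 where N0: "\<And>n. n \<ge> N0 \<Longrightarrow> norm (\<Sum>i. real (i + n) powr (- x)) < 1" by blast
  have "(\<lambda>P. real (Suc P) powr (- (x - 1))) \<longlonglongrightarrow> 0"
    using x by (intro tendsto_neg_powr filterlim_compose[OF filterlim_real_sequentially filterlim_Suc]) auto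
  then have "eventually (\<lambda>P. real (Suc P) powr (- (x - 1)) < 1 / 2) sequentially"
    by (rule order_tendstoD) simp
  then have "eventually (\<lambda>P. real (Suc P) powr (- (x - 1)) < 1 / 2 \<and> P \<ge> N0) sequentially"
    using eventually_ge_at_top[of N0] by eventually_elim simp
  then obtain P where P: "real (Suc P) powr (1 - x) < 1 / 2" "P \<ge> N0"
    by (auto simp: eventually_sequentially)
  define S where "S = {p. prime p \<and> p \<le> P}"
  have S: "finite S" unfolding S_def by (rule finite_subset[of _ "{..P}"]) auto
  have "(1 / 2) / (x - 1) \<le> (1 - real (Suc P) powr (1 - x)) / (x - 1)"
    using x P by (intro divide_right_mono) auto
  also have "\<dots> \<le> (\<Sum>n=1..P. real n powr (- x))" by (rule sum_powr_ge[OF x])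
  also have "\<dots> \<le> 2 * (\<Sum>X\<in>Pow S. real (\<Prod>X) powr (- x))"
    unfolding S_def by (rule sum_le_squarefree_sum) (use x in simp)
  finally have 1: "1 / (4 * (x - 1)) \<le> (\<Sum>X\<in>Pow S. real (\<Prod>X) powr (- x))"
    using x by (simp add: field_simps)
  have 2: "(\<Sum>n | n \<in> {1..N} \<and> (\<forall>p\<in>S. \<not> p\<^sup>2 dvd n). real n powr (- x))
        \<le> 2 * (\<Sum>X\<in>Pow S. real (\<Prod>X) powr (- x))" for N
  proof -
    have "(\<Sum>m | m \<in> {1..N} \<and> (\<forall>p\<in>S. \<not> p dvd m). real m powr (- x))
        \<le> (\<Sum>m\<in>insert 1 {Suc P..<Suc P + N}. real m powr (- x))"
    proof (rule sum_mono2)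
      show "{m \<in> {1..N}. \<forall>p\<in>S. \<not> p dvd m} \<subseteq> insert 1 {Suc P..<Suc P + N}"
      proof safe
        fix m assume m: "m \<in> {1..N}" "\<forall>p\<in>S. \<not> p dvd m" "m \<notin> {Suc P..<Suc P + N}"
        show "m = 1"
        proof (rule ccontr)
          assume "m \<noteq> 1"
          then obtain p where "prime p" "p dvd m" using prime_factor_nat by blast
          moreover have "p \<le> m" using \<open>p dvd m\<close> m by (intro dvd_imp_le) auto
          moreover have "m \<le> P" using m by auto
          ultimately show False using m(2) by (auto simp: S_def)
        qed
      qed
    qed auto
    also have "\<dots> \<le> 1 + (\<Sum>m\<in>{Suc P..<Suc P + N}. real m powr (- x))"
      by (subst sum.insert_if) auto
    also have "(\<Sum>m\<in>{Suc P..<Suc P + N}. real m powr (- x)) = (\<Sum>i<N. real (i + Suc P) powr (- x))"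
      by (rule sum.reindex_bij_witness[of _ "\<lambda>i. i + Suc P" "\<lambda>m. m - Suc P"]) auto
    also have "\<dots> \<le> (\<Sum>i. real (i + Suc P) powr (- x))"
      by (rule sum_le_suminf) (use summable_ignore_initial_segment[OF sm, of "Suc P"] in auto)
    also have "\<dots> \<le> 1" using N0[of "Suc P"] P by simp
    finally have le2: "(\<Sum>m | m \<in> {1..N} \<and> (\<forall>p\<in>S. \<not> p dvd m). real m powr (- x)) \<le> 2" by simp
    have "(\<Sum>n | n \<in> {1..N} \<and> (\<forall>p\<in>S. \<not> p\<^sup>2 dvd n). real n powr (- x)) \<le>
      (\<Sum>X\<in>Pow S. real (\<Prod>X) powr (- x)) * (\<Sum>m | m \<in> {1..N} \<and> (\<forall>p\<in>S. \<not> p dvd m). real m powr (- x))"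
      by (rule sum_free_of_prime_squares_le[OF S]) (simp add: S_def)
    also have "\<dots> \<le> (\<Sum>X\<in>Pow S. real (\<Prod>X) powr (- x)) * 2"
      by (intro mult_left_mono le2 sum_nonneg) auto
    finally show ?thesis by simp
  qed
  show ?thesis by (rule that[OF S _ 1 2]) (simp add: S_def)
qed

section \<open>Bessel's inequality for the Fourier transform\<close>

text \<open>
  The integrand is a multiple of the normal density with mean \<open>u\<close> and deviation \<open>1 / T\<close>.
\<close>

lemma nn_integral_gauss_kernel:
  assumes "T > 0"
  shows "(\<integral>\<^sup>+v. ennreal (exp (- (T * (v - u))\<^sup>2 / 2)) \<partial>lborel) = ennreal (sqrt (2 * pi) / T)"
proof -
  interpret prob_space "density lborel (normal_density u (1 / T))"
    using assms by (intro prob_space_normal_density) auto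
  have eq: "exp (- (T * (v - u))\<^sup>2 / 2) = sqrt (2 * pi) / T * normal_density u (1 / T) v" for v
    using assms by (simp add: normal_density_def real_sqrt_mult real_sqrt_divide power_mult_distrib power_divide)
  have "(\<integral>\<^sup>+v. ennreal (normal_density u (1 / T) v) \<partial>lborel) = 1"
    using emeasure_space_1 by (simp add: emeasure_density)
  then show ?thesis
    unfolding eq using assms by (subst ennreal_mult) (auto simp: nn_integral_cmult)
qed

text \<open>
  A truncated form of Plancherel's theorem. Averaging \<open>|F(T y)|\<^sup>2\<close> against the normal density
  instead of integrating over \<open>[-T, T]\<close> loses only a constant, and after Fubini the average becomes
  the quadratic form of \<open>f\<close> with a positive Gaussian kernel, whose norm is at most its integral.
\<close>

lemma bessel_inequality_fourier:
  fixes f :: "real \<Rightarrow> real"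
  assumes T: "T > 0" and int: "integrable lborel f" and sq: "integrable lborel (\<lambda>u. (f u)\<^sup>2)"
  defines "F \<equiv> (\<lambda>t. CLINT u|lborel. complex_of_real (f u) * iexp (- (t * u)))"
  shows "(\<integral>\<^sup>+t\<in>{-T..T}. ennreal ((norm (F t))\<^sup>2) \<partial>lborel)
     \<le> ennreal (2 * pi * exp (1/2) * (LINT u|lborel. (f u)\<^sup>2))"
proof -
  note [measurable] = borel_measurable_integrable[OF int, simplified]
  let ?N = "std_normal_distribution"
  let ?L = "lborel :: real measure"
  let ?k = "\<lambda>u v. exp (- (T * (v - u))\<^sup>2 / 2)"
  interpret N: real_distribution ?N by (rule real_dist_normal_dist)
  interpret NL: pair_sigma_finite ?N "?L \<Otimes>\<^sub>M ?L" ..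
  have [measurable]: "F \<in> borel_measurable borel"
    unfolding F_def by measurable
  define G where "G = (\<lambda>y (u, v). complex_of_real (f u * f v) * iexp (y * (T * (v - u))))"
  have Gm[measurable]: "case_prod G \<in> borel_measurable (?N \<Otimes>\<^sub>M (?L \<Otimes>\<^sub>M ?L))"
    unfolding G_def by measurable
  have ff: "integrable (?L \<Otimes>\<^sub>M ?L) (\<lambda>(u, v). f u * f v)"
  proof (rule lborel_pair.Fubini_integrable)
    show "integrable ?L (\<lambda>x. LINT y|?L. norm (case (x, y) of (u, v) \<Rightarrow> f u * f v))"
      using int by (simp add: abs_mult)
    show "AE x in ?L. integrable ?L (\<lambda>y. case (x, y) of (u, v) \<Rightarrow> f u * f v)"
      using int by simp
  qed measurable
  have normG: "norm (G y w) = norm (case w of (u, v) \<Rightarrow> f u * f v)" for y w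
    by (cases w) (simp add: G_def norm_mult abs_mult)
  have G1: "integrable (?L \<Otimes>\<^sub>M ?L) (G y)" for y
  proof (rule Bochner_Integration.integrable_bound[OF ff])
    show "G y \<in> borel_measurable (?L \<Otimes>\<^sub>M ?L)" unfolding G_def by measurable
  qed (simp only: normG order_refl eventually_True)
  have Gint: "integrable (?N \<Otimes>\<^sub>M (?L \<Otimes>\<^sub>M ?L)) (case_prod G)"
    by (rule NL.Fubini_integrable) (auto simp: normG G1)
  have FG: "complex_of_real ((norm (F (T * y)))\<^sup>2) = (\<integral>w. G y w \<partial>(?L \<Otimes>\<^sub>M ?L))" for y
  proof -
    have "(\<integral>w. G y w \<partial>(?L \<Otimes>\<^sub>M ?L)) = (\<integral>u. (\<integral>v. G y (u, v) \<partial>?L) \<partial>?L)"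
      by (rule lborel_pair.integral_fst'[symmetric, OF G1])
    also have "\<dots> = (\<integral>u. complex_of_real (f u) * iexp (- (T * y * u)) *
           (\<integral>v. complex_of_real (f v) * iexp (T * y * v) \<partial>?L) \<partial>?L)"
    proof (intro Bochner_Integration.integral_cong refl)
      fix u
      have "(\<integral>v. G y (u, v) \<partial>?L) = (\<integral>v. (complex_of_real (f u) * iexp (- (T * y * u))) * (complex_of_real (f v) * iexp (T * y * v)) \<partial>?L)"
        unfolding G_def
        by (intro Bochner_Integration.integral_cong refl) (simp add: exp_add[symmetric] algebra_simps)
      then show "(\<integral>v. G y (u, v) \<partial>?L) = complex_of_real (f u) * iexp (- (T * y * u)) *
           (\<integral>v. complex_of_real (f v) * iexp (T * y * v) \<partial>?L)" by simp
    qed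
    also have "\<dots> = F (T * y) * (\<integral>v. complex_of_real (f v) * iexp (T * y * v) \<partial>?L)"
      unfolding F_def by simp
    also have "(\<integral>v. complex_of_real (f v) * iexp (T * y * v) \<partial>?L) = cnj (F (T * y))"
      unfolding F_def by (simp add: Bochner_Integration.integral_cnj[symmetric] exp_cnj)
    finally show ?thesis by (simp only: complex_norm_square)
  qed
  have "complex_of_real (\<integral>y. (norm (F (T * y)))\<^sup>2 \<partial>?N) = (\<integral>y. (\<integral>w. G y w \<partial>(?L \<Otimes>\<^sub>M ?L)) \<partial>?N)"
    unfolding FG[symmetric] by (rule integral_complex_of_real[symmetric])
  also have "\<dots> = (\<integral>w. (\<integral>y. G y w \<partial>?N) \<partial>(?L \<Otimes>\<^sub>M ?L))"
    by (rule NL.Fubini_integral[symmetric, OF Gint])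
  also have "\<dots> = (\<integral>w. complex_of_real (case w of (u, v) \<Rightarrow> f u * f v * ?k u v) \<partial>(?L \<Otimes>\<^sub>M ?L))"
  proof (intro Bochner_Integration.integral_cong refl)
    fix w :: "real \<times> real"
    obtain u v where w: "w = (u, v)" by (cases w)
    have "(\<integral>y. G y w \<partial>?N) = complex_of_real (f u * f v) * char ?N (T * (v - u))"
      unfolding G_def w char_def by (simp add: mult.commute)
    also have "char ?N (T * (v - u)) = complex_of_real (?k u v)"
      unfolding char_std_normal_distribution by simp
    finally show "(\<integral>y. G y w \<partial>?N) = complex_of_real (case w of (u, v) \<Rightarrow> f u * f v * ?k u v)"
      by (simp add: w)
  qed
  also have "\<dots> = complex_of_real (\<integral>w. (case w of (u, v) \<Rightarrow> f u * f v * ?k u v) \<partial>(?L \<Otimes>\<^sub>M ?L))"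
    by (rule integral_complex_of_real)
  finally have E1: "(\<integral>y. (norm (F (T * y)))\<^sup>2 \<partial>?N) = (\<integral>w. (case w of (u, v) \<Rightarrow> f u * f v * ?k u v) \<partial>(?L \<Otimes>\<^sub>M ?L))"
    by (simp only: of_real_eq_iff)
  have Fb: "norm (F t) \<le> (LINT u|lborel. \<bar>f u\<bar>)" for t
    unfolding F_def by (rule integral_norm_bound[THEN order_trans]) (simp add: norm_mult)
  have iN: "integrable ?N (\<lambda>y. (norm (F (T * y)))\<^sup>2)"
    by (rule N.integrable_const_bound[where B = "(LINT u|lborel. \<bar>f u\<bar>)\<^sup>2"]) (auto intro!: power_mono Fb)
  have "(\<integral>\<^sup>+y. ennreal ((norm (F (T * y)))\<^sup>2) \<partial>?N) = ennreal (\<integral>y. (norm (F (T * y)))\<^sup>2 \<partial>?N)"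
    by (rule nn_integral_eq_integral[OF iN]) auto
  also have "\<dots> \<le> (\<integral>\<^sup>+w. ennreal (norm (case w of (u, v) \<Rightarrow> f u * f v * ?k u v)) \<partial>(?L \<Otimes>\<^sub>M ?L))"
  proof -
    have "integrable (?L \<Otimes>\<^sub>M ?L) (\<lambda>w. case w of (u, v) \<Rightarrow> f u * f v * ?k u v)"
      by (rule Bochner_Integration.integrable_bound[OF ff]) (auto simp: abs_mult mult_left_le)
    then have "ennreal (norm (\<integral>w. (case w of (u, v) \<Rightarrow> f u * f v * ?k u v) \<partial>(?L \<Otimes>\<^sub>M ?L))) \<le>
        (\<integral>\<^sup>+w. ennreal (norm (case w of (u, v) \<Rightarrow> f u * f v * ?k u v)) \<partial>(?L \<Otimes>\<^sub>M ?L))"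
      by (rule integral_norm_bound_ennreal)
    moreover have "(\<integral>w. (case w of (u, v) \<Rightarrow> f u * f v * ?k u v) \<partial>(?L \<Otimes>\<^sub>M ?L)) \<ge> 0"
      unfolding E1[symmetric] by simp
    ultimately show ?thesis unfolding E1 by simp
  qed
  also have "\<dots> = (\<integral>\<^sup>+u. (\<integral>\<^sup>+v. ennreal (norm (f u * f v * ?k u v)) \<partial>?L) \<partial>?L)"
    by (subst lborel.nn_integral_fst[symmetric]) auto
  also have "\<dots> \<le> (\<integral>\<^sup>+u. (\<integral>\<^sup>+v. ennreal ((f u)\<^sup>2 / 2) * ennreal (?k u v) + ennreal ((f v)\<^sup>2 / 2) * ennreal (?k u v) \<partial>?L) \<partial>?L)"
  proof (intro nn_integral_mono)
    fix u v
    have "norm (f u * f v) \<le> (f u)\<^sup>2 / 2 + (f v)\<^sup>2 / 2"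
      using sum_squares_bound[of "\<bar>f u\<bar>" "\<bar>f v\<bar>"] by (simp add: abs_mult)
    then have "norm (f u * f v * ?k u v) \<le> ((f u)\<^sup>2 / 2 + (f v)\<^sup>2 / 2) * ?k u v"
      by (simp add: abs_mult mult_right_mono)
    then have "norm (f u * f v * ?k u v) \<le> (f u)\<^sup>2 / 2 * ?k u v + (f v)\<^sup>2 / 2 * ?k u v"
      by (simp only: distrib_right)
    then have "ennreal (norm (f u * f v * ?k u v)) \<le> ennreal ((f u)\<^sup>2 / 2 * ?k u v + (f v)\<^sup>2 / 2 * ?k u v)"
      by (rule ennreal_leI)
    then show "ennreal (norm (f u * f v * ?k u v)) \<le> ennreal ((f u)\<^sup>2 / 2) * ennreal (?k u v) + ennreal ((f v)\<^sup>2 / 2) * ennreal (?k u v)"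
      by (simp only: ennreal_plus ennreal_mult zero_le_power2 divide_nonneg_nonneg zero_le_numeral exp_ge_zero mult_nonneg_nonneg)
  qed
  also have "\<dots> = (\<integral>\<^sup>+u. (\<integral>\<^sup>+v. ennreal ((f u)\<^sup>2 / 2) * ennreal (?k u v) \<partial>?L) \<partial>?L)
       + (\<integral>\<^sup>+u. (\<integral>\<^sup>+v. ennreal ((f v)\<^sup>2 / 2) * ennreal (?k u v) \<partial>?L) \<partial>?L)"
    by (simp add: nn_integral_add)
  also have "(\<integral>\<^sup>+u. (\<integral>\<^sup>+v. ennreal ((f v)\<^sup>2 / 2) * ennreal (?k u v) \<partial>?L) \<partial>?L) =
     (\<integral>\<^sup>+v. (\<integral>\<^sup>+u. ennreal ((f v)\<^sup>2 / 2) * ennreal (?k u v) \<partial>?L) \<partial>?L)"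
    by (rule lborel_pair.Fubini') measurable
  also have "\<dots> = (\<integral>\<^sup>+v. (\<integral>\<^sup>+u. ennreal ((f v)\<^sup>2 / 2) * ennreal (?k v u) \<partial>?L) \<partial>?L)"
    by (simp add: power2_commute power_mult_distrib)
  also have "(\<integral>\<^sup>+u. (\<integral>\<^sup>+v. ennreal ((f u)\<^sup>2 / 2) * ennreal (?k u v) \<partial>?L) \<partial>?L) + \<dots>
     = (\<integral>\<^sup>+u. ennreal ((f u)\<^sup>2) \<partial>?L) * ennreal (sqrt (2 * pi) / T)"
  proof -
    have "(\<integral>\<^sup>+v. ennreal ((f u)\<^sup>2 / 2) * ennreal (?k u v) \<partial>?L) = ennreal ((f u)\<^sup>2 / 2) * ennreal (sqrt (2 * pi) / T)" for u
      by (subst nn_integral_cmult, measurable, simp only: nn_integral_gauss_kernel[OF T])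
    then have "(\<integral>\<^sup>+u. (\<integral>\<^sup>+v. ennreal ((f u)\<^sup>2 / 2) * ennreal (?k u v) \<partial>?L) \<partial>?L) =
        (\<integral>\<^sup>+u. ennreal ((f u)\<^sup>2 / 2) \<partial>?L) * ennreal (sqrt (2 * pi) / T)"
      by (simp add: nn_integral_multc)
    moreover have "(\<integral>\<^sup>+u. ennreal ((f u)\<^sup>2 / 2) \<partial>?L) + (\<integral>\<^sup>+u. ennreal ((f u)\<^sup>2 / 2) \<partial>?L) = (\<integral>\<^sup>+u. ennreal ((f u)\<^sup>2) \<partial>?L)"
      by (subst nn_integral_add[symmetric]) (auto simp: ennreal_plus[symmetric] simp del: ennreal_plus)
    ultimately show ?thesis by (simp add: distrib_right[symmetric])
  qed
  also have "(\<integral>\<^sup>+u. ennreal ((f u)\<^sup>2) \<partial>?L) = ennreal (LINT u|lborel. (f u)\<^sup>2)"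
    by (rule nn_integral_eq_integral[OF sq]) auto
  finally have E2: "(\<integral>\<^sup>+y. ennreal ((norm (F (T * y)))\<^sup>2) \<partial>?N)
      \<le> ennreal (LINT u|lborel. (f u)\<^sup>2) * ennreal (sqrt (2 * pi) / T)" .
  have "(\<integral>\<^sup>+t\<in>{-T..T}. ennreal ((norm (F t))\<^sup>2) \<partial>lborel) =
     ennreal T * (\<integral>\<^sup>+y. ennreal ((norm (F (T * y)))\<^sup>2) * indicator {-T..T} (T * y) \<partial>lborel)"
    using T by (subst nn_integral_real_affine[where c = T and t = 0]) auto
  also have "\<dots> \<le> ennreal T * (\<integral>\<^sup>+y. ennreal (exp (1/2) * sqrt (2 * pi)) *
       (ennreal (std_normal_density y) * ennreal ((norm (F (T * y)))\<^sup>2)) \<partial>lborel)"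
  proof (intro mult_left_mono nn_integral_mono)
    fix y
    show "ennreal ((norm (F (T * y)))\<^sup>2) * indicator {-T..T} (T * y) \<le>
      ennreal (exp (1/2) * sqrt (2 * pi)) * (ennreal (std_normal_density y) * ennreal ((norm (F (T * y)))\<^sup>2))"
    proof (cases "T * y \<in> {-T..T}")
      case True
      have "T * y \<le> T * 1" "T * (- 1) \<le> T * y" using True by auto
      then have "\<bar>y\<bar> \<le> 1" using T by (auto simp only: mult_le_cancel_left_pos)
      then have "y\<^sup>2 \<le> 1" by (simp add: abs_square_le_1)
      then have "1 \<le> exp (1/2) * sqrt (2 * pi) * std_normal_density y"
        by (simp add: std_normal_density_def exp_add[symmetric])
      then have "1 * (norm (F (T * y)))\<^sup>2 \<le> (exp (1/2) * sqrt (2 * pi) * std_normal_density y) * (norm (F (T * y)))\<^sup>2"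
        by (rule mult_right_mono) simp
      then show ?thesis using True by (simp add: ennreal_mult[symmetric] mult.assoc)
    qed auto
  qed simp
  also have "\<dots> = ennreal T * (ennreal (exp (1/2) * sqrt (2 * pi)) * (\<integral>\<^sup>+y. ennreal ((norm (F (T * y)))\<^sup>2) \<partial>?N))"
    by (simp add: nn_integral_cmult nn_integral_density)
  also have "\<dots> \<le> ennreal T * (ennreal (exp (1/2) * sqrt (2 * pi)) * (ennreal (LINT u|lborel. (f u)\<^sup>2) * ennreal (sqrt (2 * pi) / T)))"
    by (intro mult_left_mono E2) auto
  also have "\<dots> = ennreal (T * ((exp (1/2) * sqrt (2 * pi)) * ((LINT u|lborel. (f u)\<^sup>2) * (sqrt (2 * pi) / T))))"
    using T by (simp add: ennreal_mult[symmetric])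
  also have "T * ((exp (1/2) * sqrt (2 * pi)) * ((LINT u|lborel. (f u)\<^sup>2) * (sqrt (2 * pi) / T))) =
      2 * pi * exp (1/2) * (LINT u|lborel. (f u)\<^sup>2)"
    using T by (simp add: field_simps)
  finally show ?thesis .
qed

section \<open>Error terms of summatory functions and their transforms\<close>

definition summatory_error :: "(nat \<Rightarrow> real) \<Rightarrow> real \<Rightarrow> real \<Rightarrow> real" where
  "summatory_error a c u = (\<Sum>n=1..nat \<lfloor>exp u\<rfloor>. a n) - c * exp u"

text \<open>
  In the variable \<open>u = ln y\<close> this says that \<open>Z(s) / s\<close> is the Mellin transform at \<open>- s\<close> of the error
  term \<open>(\<Sum>n\<le>y. a n) - c y\<close>; formally \<open>Z\<close> is the Dirichlet series with coefficients \<open>a\<close>, continued to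
  the critical strip. The bound by \<open>min 1 (exp u)\<close> makes the integral converge absolutely there.
\<close>

definition error_transform :: "(nat \<Rightarrow> real) \<Rightarrow> real \<Rightarrow> (complex \<Rightarrow> complex) \<Rightarrow> bool" where
  "error_transform a c Z \<longleftrightarrow>
     (\<exists>B. \<forall>u. \<bar>summatory_error a c u\<bar> \<le> B * min 1 (exp u)) \<and>
     (\<forall>s. 0 < Re s \<and> Re s < 1 \<longrightarrow>
        (CLINT u|lborel. complex_of_real (summatory_error a c u) * exp (- (s * u))) = Z s / s)"

lemma summatory_error_measurable [measurable]: "summatory_error a c \<in> borel_measurable borel"
proof -
  have m: "(\<lambda>u::real. nat \<lfloor>exp u\<rfloor>) \<in> borel \<rightarrow>\<^sub>M count_space UNIV" by measurable
  have "(\<lambda>N. \<Sum>n=1..N. a n) \<in> count_space UNIV \<rightarrow>\<^sub>M borel" by simp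
  from measurable_compose[OF m this]
  have [measurable]: "(\<lambda>u::real. \<Sum>n=1..nat \<lfloor>exp u\<rfloor>. a n) \<in> borel_measurable borel" .
  show ?thesis unfolding summatory_error_def[abs_def] by measurable
qed

lemma nn_integral_exp_atLeast:
  fixes k a :: real
  assumes k: "k > 0"
  shows "(\<integral>\<^sup>+u. ennreal (exp (- (k * u))) * indicator {a..} u \<partial>lborel) = ennreal (exp (- (k * a)) / k)"
proof -
  have "((\<lambda>u. - exp (- (k * u)) / k) \<longlongrightarrow> 0) at_top" using k by real_asymp
  then have "(\<integral>\<^sup>+u. ennreal (exp (- (k * u))) * indicator {a..} u \<partial>lborel) = ennreal (0 - (- exp (- (k * a)) / k))"
    using k by (intro nn_integral_FTC_atLeast) (auto intro!: derivative_eq_intros)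
  then show ?thesis by simp
qed

lemma nn_integral_exp_atMost:
  fixes k a :: real
  assumes k: "k > 0"
  shows "(\<integral>\<^sup>+u. ennreal (exp (k * u)) * indicator {..a} u \<partial>lborel) = ennreal (exp (k * a) / k)"
proof -
  have "(\<integral>\<^sup>+u. ennreal (exp (k * u)) * indicator {..a} u \<partial>lborel) =
     (\<integral>\<^sup>+u. ennreal (exp (- (k * u))) * indicator {-a..} u \<partial>lborel)"
    by (subst nn_integral_real_affine[where c = "-1" and t = 0])
       (auto intro!: nn_integral_cong split: split_indicator)
  then show ?thesis using nn_integral_exp_atLeast[OF k, of "-a"] by simp
qed

lemma integrable_min_exp:
  fixes x :: real
  assumes "0 < x" "x < 1"
  shows "integrable lborel (\<lambda>u. min 1 (exp u) * exp (- (x * u)))"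
proof (rule integrableI_bounded)
  have "(\<integral>\<^sup>+u. ennreal (norm (min 1 (exp u) * exp (- (x * u)))) \<partial>lborel) \<le>
    (\<integral>\<^sup>+u. ennreal (exp (- (x * u))) * indicator {0..} u + ennreal (exp ((1 - x) * u)) * indicator {..0} u \<partial>lborel)"
  proof (rule nn_integral_mono)
    fix u :: real
    have "exp ((1 - x) * u) = exp u * exp (- (x * u))" by (simp add: exp_add[symmetric] algebra_simps)
    then show "ennreal (norm (min 1 (exp u) * exp (- (x * u)))) \<le>
      ennreal (exp (- (x * u))) * indicator {0..} u + ennreal (exp ((1 - x) * u)) * indicator {..0} u"
      by (cases "u < 0"; cases "u = 0") (auto simp: min_def intro!: ennreal_leI)
  qed
  also have "\<dots> = ennreal (exp (- (x * 0)) / x) + ennreal (exp ((1 - x) * 0) / (1 - x))"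
    using assms nn_integral_exp_atLeast[of x 0] nn_integral_exp_atMost[of "1 - x" 0]
    by (subst nn_integral_add) auto
  also have "\<dots> < \<infinity>" by simp
  finally show "(\<integral>\<^sup>+u. ennreal (norm (min 1 (exp u) * exp (- (x * u)))) \<partial>lborel) < \<infinity>" .
qed measurable

lemma summatory_error_dominated:
  fixes s :: complex
  assumes "\<bar>summatory_error a c u\<bar> \<le> B * min 1 (exp u)"
  shows "norm (complex_of_real (summatory_error a c u) * exp (- (s * u))) \<le>
    B * (min 1 (exp u) * exp (- (Re s * u)))"
proof -
  have "norm (complex_of_real (summatory_error a c u) * exp (- (s * u))) =
      \<bar>summatory_error a c u\<bar> * exp (- (Re s * u))"
    by (simp add: norm_mult)
  also have "\<dots> \<le> (B * min 1 (exp u)) * exp (- (Re s * u))"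
    by (intro mult_right_mono assms) simp
  finally show ?thesis by (simp only: mult.assoc)
qed

lemma integrable_summatory_error:
  fixes s :: complex
  assumes "\<forall>u. \<bar>summatory_error a c u\<bar> \<le> B * min 1 (exp u)" "0 < Re s" "Re s < 1"
  shows "integrable lborel (\<lambda>u. complex_of_real (summatory_error a c u) * exp (- (s * u)))"
proof (rule Bochner_Integration.integrable_bound)
  show "integrable lborel (\<lambda>u. B * (min 1 (exp u) * exp (- (Re s * u))))"
    by (intro integrable_mult_right integrable_min_exp assms)
  show "AE u in lborel. norm (complex_of_real (summatory_error a c u) * exp (- (s * u))) \<le>
    norm (B * (min 1 (exp u) * exp (- (Re s * u))))"
  proof (rule AE_I2)
    fix u
    have "norm (complex_of_real (summatory_error a c u) * exp (- (s * u))) \<le> B * (min 1 (exp u) * exp (- (Re s * u)))"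
      by (rule summatory_error_dominated) (use assms(1) in blast)
    also have "\<dots> \<le> norm (B * (min 1 (exp u) * exp (- (Re s * u))))"
      unfolding real_norm_def by (rule abs_ge_self)
    finally show "norm (complex_of_real (summatory_error a c u) * exp (- (s * u))) \<le> norm (B * (min 1 (exp u) * exp (- (Re s * u))))" .
  qed
qed measurable

lemma zeta_rem_term_1:
  "zeta_rem_term 1 (Suc n) s = of_nat (Suc (Suc n)) powr (1 - s) - of_nat (Suc n) powr (1 - s) - (1 - s) * of_nat (Suc n) powr (- s)"
proof -
  have "1 - s - 1 = - s" by simp
  then show ?thesis unfolding zeta_rem_term_def by simp
qed

lemma zeta_Re_pos:
  assumes "Re s > 0" "s \<noteq> 1"
  shows "(s - 1) * zeta s = 1 + (\<Sum>n. zeta_rem_term 1 (Suc n) s)"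
proof (rule holomorphic_eq_right_half_plane[of "\<lambda>s. (s - 1) * zeta s" "{s. Re s > 0} - {1}"
      "\<lambda>s. 1 + (\<Sum>n. zeta_rem_term 1 (Suc n) s)"])
  show "(\<lambda>s. (s - 1) * zeta s) holomorphic_on {s. 0 < Re s} - {1}"
    using is_zeta_zeta unfolding is_zeta_def by (auto intro!: holomorphic_intros elim: holomorphic_on_subset)
  show "(\<lambda>s. 1 + (\<Sum>n. zeta_rem_term 1 (Suc n) s)) holomorphic_on {s. 0 < Re s} - {1}"
    using holomorphic_zeta_rem[of 1] by (auto intro!: holomorphic_intros elim: holomorphic_on_subset)
  show "open ({s. 0 < Re s} - {1})" using open_Re_gt[of 0] by auto
  show "connected ({s. 0 < Re s} - {1})"
    using open_Re_gt[of 0] convex_halfspace_Re_gt[of 0]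
    by (intro connected_open_delete) (auto intro: convex_connected)
  show "(s - 1) * zeta s = 1 + (\<Sum>n. zeta_rem_term 1 (Suc n) s)" if "1 < Re s" for s
  proof -
    have "zeta s = zeta_series s" using is_zeta_zeta that by (auto simp: is_zeta_def zeta_series_def)
    then show ?thesis using zeta_series_recurrence[OF that, of 0] by simp
  qed
qed (use assms in auto)

text \<open>
  The series in \<open>zeta_Re_pos\<close> telescopes apart from the terms \<open>(1 - s) n\<^sup>-\<^sup>s\<close>. So the Dirichlet series
  converges to \<open>zeta s\<close> once the integral of \<open>t\<^sup>-\<^sup>s\<close>, up to a constant, is subtracted.
\<close>

lemma zeta_limit:
  assumes s: "Re s > 0" "s \<noteq> 1"
  shows "(\<lambda>K. (\<Sum>n=1..K. exp (- (s * ln (real n)))) - of_nat (Suc K) * exp (- (s * ln (real (Suc K)))) / (1 - s))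
     \<longlonglongrightarrow> zeta s"
proof -
  have pw: "of_nat (Suc n) powr (- s) = exp (- (s * ln (real (Suc n))))"
     "of_nat (Suc n) powr (1 - s) = of_nat (Suc n) * exp (- (s * ln (real (Suc n))))" for n
  proof -
    have L: "ln (complex_of_nat (Suc n)) = of_real (ln (real (Suc n)))"
      using Ln_of_real[of "real (Suc n)"] by simp
    show "of_nat (Suc n) powr (- s) = exp (- (s * ln (real (Suc n))))"
      unfolding powr_def L by (simp del: of_nat_Suc)
    have "of_nat (Suc n) powr (1 - s) = exp (of_real (ln (real (Suc n)))) * exp (- (s * ln (real (Suc n))))"
      unfolding powr_def L by (simp add: exp_add[symmetric] algebra_simps del: of_real_exp of_nat_Suc)
    then show "of_nat (Suc n) powr (1 - s) = of_nat (Suc n) * exp (- (s * ln (real (Suc n))))"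
      by (simp add: exp_of_real del: of_nat_Suc)
  qed
  have "summable (\<lambda>n. zeta_rem_term 1 (Suc n) s)"
    by (rule zeta_rem_uniform[of 1 s]) (use s in simp)
  then have "(\<lambda>K. (1 + (\<Sum>n<K. zeta_rem_term 1 (Suc n) s)) / (s - 1)) \<longlonglongrightarrow> (1 + (\<Sum>n. zeta_rem_term 1 (Suc n) s)) / (s - 1)"
    using s by (intro tendsto_intros summable_LIMSEQ) auto
  also have "(1 + (\<Sum>n. zeta_rem_term 1 (Suc n) s)) / (s - 1) = zeta s"
    using s unfolding zeta_Re_pos[OF s, symmetric] by simp
  also have "(\<lambda>K. (1 + (\<Sum>n<K. zeta_rem_term 1 (Suc n) s)) / (s - 1)) =
     (\<lambda>K. (\<Sum>n=1..K. exp (- (s * ln (real n)))) - of_nat (Suc K) * exp (- (s * ln (real (Suc K)))) / (1 - s))"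
  proof
    fix K
    have alg: "(Y - (1 - s) * X) / (s - 1) = X - Y / (1 - s)" for X Y
    proof -
      have "s - 1 \<noteq> 0" "1 - s \<noteq> 0" using s by auto
      then show ?thesis by (simp add: field_simps)
    qed
    have "(1 + (\<Sum>n<K. zeta_rem_term 1 (Suc n) s)) = of_nat (Suc K) * exp (- (s * ln (real (Suc K)))) - (1 - s) * (\<Sum>n=1..K. exp (- (s * ln (real n))))"
    proof (induction K)
      case (Suc K)
      have e: "zeta_rem_term 1 (Suc K) s = of_nat (Suc (Suc K)) * exp (- (s * ln (real (Suc (Suc K)))))
          - of_nat (Suc K) * exp (- (s * ln (real (Suc K)))) - (1 - s) * exp (- (s * ln (real (Suc K))))"
        unfolding zeta_rem_term_1 pw ..
      have "1 + (\<Sum>n<Suc K. zeta_rem_term 1 (Suc n) s) = (1 + (\<Sum>n<K. zeta_rem_term 1 (Suc n) s)) + zeta_rem_term 1 (Suc K) s"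
        by simp
      also have "\<dots> = of_nat (Suc (Suc K)) * exp (- (s * ln (real (Suc (Suc K)))))
         - (1 - s) * ((\<Sum>n=1..K. exp (- (s * ln (real n)))) + exp (- (s * ln (real (Suc K)))))"
        unfolding Suc e by (simp only: algebra_simps)
      finally show ?case by simp
    qed simp
    then have "(1 + (\<Sum>n<K. zeta_rem_term 1 (Suc n) s)) / (s - 1) = (of_nat (Suc K) * exp (- (s * ln (real (Suc K)))) - (1 - s) * (\<Sum>n=1..K. exp (- (s * ln (real n))))) / (s - 1)"
      by (rule arg_cong)
    also have "\<dots> = (\<Sum>n=1..K. exp (- (s * ln (real n)))) - of_nat (Suc K) * exp (- (s * ln (real (Suc K)))) / (1 - s)"
      by (rule alg)
    finally show "(1 + (\<Sum>n<K. zeta_rem_term 1 (Suc n) s)) / (s - 1) =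
      (\<Sum>n=1..K. exp (- (s * ln (real n)))) - of_nat (Suc K) * exp (- (s * ln (real (Suc K)))) / (1 - s)" .
  qed
  finally show ?thesis .
qed

text \<open>
  Where the number of positive integers up to \<open>e\<^sup>u\<close> is constantly \<open>c\<close>, this is the integrand
  of the transform of the error term.
\<close>

lemma has_integral_exp_piece:
  fixes s :: complex and a b :: real and c :: complex
  assumes "a \<le> b" "s \<noteq> 0" "s \<noteq> 1"
  defines "P \<equiv> (\<lambda>u::real. - (c * exp (- (s * u)) / s) - exp ((1 - s) * u) / (1 - s))"
  shows "((\<lambda>u. (c - of_real (exp u)) * exp (- (s * of_real u))) has_integral (P b - P a)) {a..b}"
proof (rule fundamental_theorem_of_calculus[OF assms(1)])
  fix u :: real
  have "((\<lambda>z. - (c * exp (- (s * z)) / s) - exp ((1 - s) * z) / (1 - s)) has_field_derivative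
      c * exp (- (s * of_real u)) - exp ((1 - s) * of_real u)) (at (of_real u))"
    using assms(2,3) by (auto intro!: derivative_eq_intros)
  then have "(P has_vector_derivative (c * exp (- (s * of_real u)) - exp ((1 - s) * of_real u))) (at u within {a..b})"
    unfolding P_def by (rule has_vector_derivative_real_field)
  also have "c * exp (- (s * of_real u)) - exp ((1 - s) * of_real u) = (c - of_real (exp u)) * exp (- (s * of_real u))"
    by (simp add: exp_of_real[symmetric] left_diff_distrib exp_diff exp_minus field_simps)
  finally show "(P has_vector_derivative ((c - of_real (exp u)) * exp (- (s * of_real u)))) (at u within {a..b})" .
qed

lemma summatory_error_one: "summatory_error (\<lambda>_. 1) 1 u = real (nat \<lfloor>exp u\<rfloor>) - exp u"
  by (simp add: summatory_error_def)

text \<open>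
  The integral over \<open>[-K, ln (K + 1)]\<close> is computed piece by piece between the logarithms of
  consecutive integers; by partial summation it agrees with \<open>1 / s\<close> times the sequence of
  \<open>zeta_limit\<close>, up to terms that tend to zero.
\<close>

lemma error_transform_zeta: "error_transform (\<lambda>_. 1) 1 zeta"
proof -
  have bd: "\<forall>u. \<bar>summatory_error (\<lambda>_. 1) 1 u\<bar> \<le> 1 * min 1 (exp u)"
  proof
    fix u :: real
    have "real (nat \<lfloor>exp u\<rfloor>) = of_int \<lfloor>exp u\<rfloor>" "of_int \<lfloor>exp u\<rfloor> \<ge> (0::real)" by simp_all
    moreover have "of_int \<lfloor>exp u\<rfloor> \<le> exp u" "exp u < of_int \<lfloor>exp u\<rfloor> + 1" by linarith+
    ultimately show "\<bar>summatory_error (\<lambda>_. 1) 1 u\<bar> \<le> 1 * min 1 (exp u)"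
      unfolding summatory_error_one by linarith
  qed
  moreover have "(CLINT u|lborel. complex_of_real (summatory_error (\<lambda>_. 1) 1 u) * exp (- (s * u))) = zeta s / s"
    if s: "0 < Re s" "Re s < 1" for s
  proof -
    have s01: "s \<noteq> 0" "s \<noteq> 1" using s by auto
    define g where "g = (\<lambda>u::real. complex_of_real (summatory_error (\<lambda>_. 1) 1 u) * exp (- (s * u)))"
    have g: "integrable lborel g"
      unfolding g_def by (rule integrable_summatory_error[OF bd s])
    define P where "P = (\<lambda>n (u::real). - (of_nat n * exp (- (s * u)) / s) - exp ((1 - s) * u) / (1 - s))"
    have piece: "(g has_integral (P n b - P n a)) {a..b}"
      if "a \<le> b" "\<And>u. a \<le> u \<Longrightarrow> u < b \<Longrightarrow> nat \<lfloor>exp u\<rfloor> = n" for a b n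
    proof (rule has_integral_spike_finite[of "{b}"])
      show "((\<lambda>u. (of_nat n - of_real (exp u)) * exp (- (s * of_real u))) has_integral (P n b - P n a)) {a..b}"
        unfolding P_def by (rule has_integral_exp_piece) (use that s01 in auto)
      show "g u = (of_nat n - of_real (exp u)) * exp (- (s * of_real u))" if "u \<in> {a..b} - {b}" for u
        unfolding g_def summatory_error_one using that \<open>\<And>u. a \<le> u \<Longrightarrow> u < b \<Longrightarrow> nat \<lfloor>exp u\<rfloor> = n\<close>[of u]
        by simp
    qed simp
    define q where "q = (\<lambda>n::nat. exp (- (s * ln (real n))))"
    have Pq: "P m (ln (real (Suc n))) = - (of_nat m * q (Suc n) / s) - of_nat (Suc n) * q (Suc n) / (1 - s)" for m n
    proof -
      have "exp ((1 - s) * of_real (ln (real (Suc n)))) = exp (of_real (ln (real (Suc n)))) * q (Suc n)"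
        unfolding q_def by (simp add: exp_add[symmetric] algebra_simps del: of_real_exp of_nat_Suc)
      then show ?thesis unfolding P_def by (simp add: exp_of_real q_def del: of_nat_Suc)
    qed
    \<comment> \<open>The integral over \<open>[0, ln (K + 1)]\<close> after summation by parts.\<close>
    define W where "W = (\<lambda>K. ((\<Sum>n=1..K. q n) - of_nat K * q (Suc K)) / s - (of_nat (Suc K) * q (Suc K) - 1) / (1 - s))"
    have pos: "(g has_integral W K) {0..ln (real (Suc K))}" for K
    proof (induction K)
      case 0
      have "W 0 = 0" by (simp add: W_def q_def)
      then show ?case by (simp add: has_integral_refl)
    next
      case (Suc K)
      have "(g has_integral (P (Suc K) (ln (real (Suc (Suc K)))) - P (Suc K) (ln (real (Suc K))))) {ln (real (Suc K))..ln (real (Suc (Suc K)))}"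
      proof (rule piece)
        fix u assume "ln (real (Suc K)) \<le> u" "u < ln (real (Suc (Suc K)))"
        then have "exp (ln (real (Suc K))) \<le> exp u" "exp u < exp (ln (real (Suc (Suc K))))"
          by (simp_all only: exp_le_cancel_iff exp_less_cancel_iff)
        then have "real (Suc K) \<le> exp u" "exp u < real (Suc (Suc K))" by simp_all
        then have "\<lfloor>exp u\<rfloor> = int (Suc K)" by (intro floor_unique) auto
        then show "nat \<lfloor>exp u\<rfloor> = Suc K" by simp
      qed auto
      with Suc have "(g has_integral (W K + (P (Suc K) (ln (real (Suc (Suc K)))) - P (Suc K) (ln (real (Suc K)))))) {0..ln (real (Suc (Suc K)))}"
        by (intro has_integral_combine[of 0 "ln (real (Suc K))"]) auto
      also have "W K + (P (Suc K) (ln (real (Suc (Suc K)))) - P (Suc K) (ln (real (Suc K)))) = W (Suc K)"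
        unfolding Pq W_def by (simp add: diff_divide_distrib add_divide_distrib algebra_simps)
      finally show ?case .
    qed
    have neg: "(g has_integral ((exp (- ((1 - s) * of_nat K)) - 1) / (1 - s))) {- real K..0}" for K
    proof -
      have "(g has_integral (P 0 0 - P 0 (- real K))) {- real K..0}"
      proof (rule piece)
        fix u :: real assume "u < 0"
        then have "\<lfloor>exp u\<rfloor> = 0" by (intro floor_unique) auto
        then show "nat \<lfloor>exp u\<rfloor> = 0" by simp
      qed simp
      also have "P 0 0 - P 0 (- real K) = (exp (- ((1 - s) * of_nat K)) - 1) / (1 - s)"
        by (simp add: P_def diff_divide_distrib)
      finally show ?thesis .
    qed
    have val: "(CLINT u|lborel. indicator {- real K..ln (real (Suc K))} u *\<^sub>R g u) =
       (exp (- ((1 - s) * of_nat K)) - 1) / (1 - s) + W K" for K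
    proof -
      have si: "set_integrable lborel {- real K..ln (real (Suc K))} g"
        unfolding set_integrable_def by (rule integrable_mult_indicator[OF _ g]) simp
      have "(g has_integral ((exp (- ((1 - s) * of_nat K)) - 1) / (1 - s) + W K)) {- real K..ln (real (Suc K))}"
        using neg[of K] pos[of K] by (intro has_integral_combine[of _ 0]) auto
      with set_borel_integral_eq_integral(2)[OF si] show ?thesis
        unfolding set_lebesgue_integral_def by (simp add: integral_unique)
    qed
    have lim1: "(\<lambda>K. CLINT u|lborel. indicator {- real K..ln (real (Suc K))} u *\<^sub>R g u) \<longlonglongrightarrow> (CLINT u|lborel. g u)"
    proof (rule integral_dominated_convergence)
      show "integrable lborel (\<lambda>u. norm (g u))" by (rule integrable_norm[OF g])
      show "AE u in lborel. (\<lambda>K. indicator {- real K..ln (real (Suc K))} u *\<^sub>R g u) \<longlonglongrightarrow> g u"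
      proof (rule AE_I2, rule tendsto_eventually)
        fix u :: real
        have "eventually (\<lambda>K. real K \<ge> - u) sequentially"
          by (rule eventually_compose_filterlim[OF eventually_ge_at_top filterlim_real_sequentially])
        moreover have "eventually (\<lambda>K. real K \<ge> exp u) sequentially"
          by (rule eventually_compose_filterlim[OF eventually_ge_at_top filterlim_real_sequentially])
        ultimately show "eventually (\<lambda>K. indicator {- real K..ln (real (Suc K))} u *\<^sub>R g u = g u) sequentially"
        proof eventually_elim
          case (elim K)
          then have "exp u \<le> real (Suc K)" by simp
          then have "u \<le> ln (real (Suc K))" by (subst ln_ge_iff) auto
          then show ?case using elim by simp
        qed
      qed
    qed (use g in \<open>auto split: split_indicator\<close>)
    have qlim: "q \<longlonglongrightarrow> 0"
    proof (rule tendsto_norm_zero_cancel, rule Lim_transform_eventually)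
      show "(\<lambda>n. real n powr (- Re s)) \<longlonglongrightarrow> 0"
        using s by (intro tendsto_neg_powr filterlim_real_sequentially) auto
      show "eventually (\<lambda>n. real n powr (- Re s) = norm (q n)) sequentially"
        using eventually_gt_at_top[of 0] by eventually_elim (simp add: q_def powr_def)
    qed
    have elim: "(\<lambda>K. exp (- ((1 - s) * of_nat K))) \<longlonglongrightarrow> 0"
    proof (rule tendsto_norm_zero_cancel)
      have "(\<lambda>K. exp (- ((1 - Re s) * real K))) \<longlonglongrightarrow> 0"
        using s by real_asymp
      then show "(\<lambda>K. norm (exp (- ((1 - s) * of_nat K)))) \<longlonglongrightarrow> 0" by simp
    qed
    have "(\<lambda>K. exp (- ((1 - s) * of_nat K)) / (1 - s) + q (Suc K) / s +
        ((\<Sum>n=1..K. q n) - of_nat (Suc K) * q (Suc K) / (1 - s)) / s) \<longlonglongrightarrow> 0 / (1 - s) + 0 / s + zeta s / s"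
      unfolding q_def using s01 zeta_limit[of s] s elim LIMSEQ_Suc[OF qlim]
      by (intro tendsto_intros) (auto simp: q_def)
    also have "(\<lambda>K. exp (- ((1 - s) * of_nat K)) / (1 - s) + q (Suc K) / s +
        ((\<Sum>n=1..K. q n) - of_nat (Suc K) * q (Suc K) / (1 - s)) / s) =
       (\<lambda>K. (exp (- ((1 - s) * of_nat K)) - 1) / (1 - s) + W K)"
    proof
      fix K
      have alg: "e / (1 - s) + b / s + (A - k * b / (1 - s)) / s = (e - 1) / (1 - s) + ((A - (k - 1) * b) / s - (k * b - 1) / (1 - s))"
        for e b A k :: complex
      proof -
        have "s \<noteq> 0" "1 - s \<noteq> 0" using s01 by auto
        then show ?thesis by (simp add: divide_simps) (simp add: algebra_simps)
      qed
      show "exp (- ((1 - s) * of_nat K)) / (1 - s) + q (Suc K) / s +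
        ((\<Sum>n=1..K. q n) - of_nat (Suc K) * q (Suc K) / (1 - s)) / s = (exp (- ((1 - s) * of_nat K)) - 1) / (1 - s) + W K"
        unfolding W_def alg by simp
    qed
    finally have "(\<lambda>K. CLINT u|lborel. indicator {- real K..ln (real (Suc K))} u *\<^sub>R g u) \<longlonglongrightarrow> zeta s / s"
      unfolding val by simp
    with lim1 have "(CLINT u|lborel. g u) = zeta s / s" by (rule LIMSEQ_unique)
    then show ?thesis unfolding g_def .
  qed
  ultimately show ?thesis unfolding error_transform_def by blast
qed

lemma nat_floor_exp_minus_ln:
  assumes "p > 0"
  shows "nat \<lfloor>exp (u - ln (real p))\<rfloor> = nat \<lfloor>exp u\<rfloor> div p"
proof -
  have "exp (u - ln (real p)) = exp u / real_of_int (int p)" using assms by (simp add: exp_diff)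
  then have "\<lfloor>exp (u - ln (real p))\<rfloor> = \<lfloor>exp u\<rfloor> div int p"
    using floor_divide_real_eq_div[of "int p" "exp u"] by simp
  then show ?thesis by (simp add: nat_div_distrib)
qed

lemma sum_multiples:
  fixes a :: "nat \<Rightarrow> real"
  assumes "p > 0"
  shows "(\<Sum>n=1..N. if p dvd n then a (n div p) else 0) = (\<Sum>m=1..N div p. a m)"
proof -
  have "(\<Sum>n=1..N. if p dvd n then a (n div p) else 0) = (\<Sum>n | n \<in> {1..N} \<and> p dvd n. a (n div p))"
    by (rule sum.inter_filter[symmetric]) simp
  also have "\<dots> = (\<Sum>m=1..N div p. a m)"
  proof (rule sum.reindex_bij_witness[of _ "\<lambda>m. p * m" "\<lambda>n. n div p"])
    fix n assume "n \<in> {n \<in> {1..N}. p dvd n}"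
    then show "n div p \<in> {1..N div p}"
      using assms by (auto simp: div_le_mono dvd_imp_le div_greater_zero_iff Suc_le_eq)
  next
    fix m assume "m \<in> {1..N div p}"
    then have "p * m \<le> N" "p * m > 0" using assms by (auto simp: less_eq_div_iff_mult_less_eq mult.commute)
    then show "p * m \<in> {n \<in> {1..N}. p dvd n}" by simp
  qed (use assms in auto)
  finally show ?thesis .
qed

text \<open>
  Multiplying a Dirichlet series by \<open>1 - p\<^sup>-\<^sup>s\<close> subtracts from the error term its translate
  by \<open>ln p\<close>.
\<close>

lemma summatory_error_euler_factor:
  assumes "p > 0"
  shows "summatory_error (\<lambda>n. a n - (if p dvd n then a (n div p) else 0)) (c - c / real p) u
    = summatory_error a c u - summatory_error a c (u - ln (real p))"
  unfolding summatory_error_def sum_subtractf sum_multiples[OF assms] nat_floor_exp_minus_ln[OF assms]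
  using assms by (simp add: exp_diff algebra_simps)

lemma error_transform_euler_factor:
  assumes E: "error_transform a c Z" and p: "p > 0"
  shows "error_transform (\<lambda>n. a n - (if p dvd n then a (n div p) else 0)) (c - c / real p)
     (\<lambda>s. Z s * (1 - exp (- (s * ln (real p)))))"
proof -
  obtain B where B: "\<forall>u. \<bar>summatory_error a c u\<bar> \<le> B * min 1 (exp u)"
    using E unfolding error_transform_def by blast
  have "B \<ge> 0" using B[rule_format, of 0] by simp
  have "\<bar>summatory_error a c u - summatory_error a c (u - ln (real p))\<bar> \<le> (2 * B) * min 1 (exp u)" for u
  proof -
    have "exp (u - ln (real p)) \<le> exp u" using p by simp
    then have "B * min 1 (exp (u - ln (real p))) \<le> B * min 1 (exp u)"
      using \<open>B \<ge> 0\<close> by (intro mult_left_mono min.mono) auto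
    then show ?thesis using B[rule_format, of u] B[rule_format, of "u - ln (real p)"] by simp
  qed
  moreover have "(CLINT u|lborel. complex_of_real (summatory_error a c u - summatory_error a c (u - ln (real p))) * exp (- (s * u)))
       = Z s * (1 - exp (- (s * ln (real p)))) / s" if s: "0 < Re s \<and> Re s < 1" for s
  proof -
    let ?g = "\<lambda>u. complex_of_real (summatory_error a c u) * exp (- (s * u))"
    have g: "integrable lborel ?g" by (rule integrable_summatory_error[OF B]) (use s in auto)
    have gs: "complex_of_real (summatory_error a c u - summatory_error a c (u - ln (real p))) * exp (- (s * u)) =
       ?g u - exp (- (s * ln (real p))) * ?g (- ln (real p) + 1 * u)" for u
    proof -
      have "exp (- (s * u)) = exp (- (s * ln (real p))) * exp (- (s * complex_of_real (- ln (real p) + 1 * u)))"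
        by (simp add: exp_add[symmetric] algebra_simps)
      then show ?thesis by (simp add: algebra_simps)
    qed
    have "(CLINT u|lborel. ?g (- ln (real p) + 1 * u)) = (CLINT u|lborel. ?g u)"
      using lborel_integral_real_affine[of 1 ?g "- ln (real p)"] by simp
    moreover have "integrable lborel (\<lambda>u. ?g (- ln (real p) + 1 * u))"
      by (rule lborel_integrable_real_affine[OF g]) simp
    ultimately have "(CLINT u|lborel. ?g u - exp (- (s * ln (real p))) * ?g (- ln (real p) + 1 * u)) =
       (CLINT u|lborel. ?g u) - exp (- (s * ln (real p))) * (CLINT u|lborel. ?g u)"
      using g by (simp only: Bochner_Integration.integral_diff integrable_mult_right integral_mult_right_zero)
    also have "(CLINT u|lborel. ?g u) = Z s / s" using E s unfolding error_transform_def by blast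
    finally show ?thesis unfolding gs by (simp add: right_diff_distrib diff_divide_distrib mult.commute)
  qed
  ultimately show ?thesis
    unfolding error_transform_def summatory_error_euler_factor[OF p] by blast
qed

text \<open>
  The coefficients of \<open>zeta(s) (\<Prod>p\<in>S. (1 - p\<^sup>-\<^sup>s)\<^sup>2)\<close> for a finite set \<open>S\<close> of primes: the local factor
  at \<open>p \<in> S\<close> is \<open>(1 - p\<^sup>-\<^sup>s)\<^sup>2 / (1 - p\<^sup>-\<^sup>s) = 1 - p\<^sup>-\<^sup>s\<close>.
\<close>

definition euler_square_coeff :: "nat set \<Rightarrow> nat \<Rightarrow> real" where
  "euler_square_coeff S n =
     (if \<exists>p\<in>S. p\<^sup>2 dvd n then 0 else (-1) ^ card {p \<in> S. p dvd n})"

text \<open>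
  The first factor \<open>1 - p\<^sup>-\<^sup>s\<close> removes the multiples of \<open>p\<close>, as the coefficients for \<open>S\<close> do not
  change when their argument is multiplied by \<open>p\<close>. The second one puts the exact multiples back
  with the opposite sign.
\<close>

lemma euler_square_coeff_insert:
  fixes p :: nat
  assumes p: "prime p" "p \<notin> S" and S: "finite S" "\<And>q. q \<in> S \<Longrightarrow> prime q"
  defines "b \<equiv> (\<lambda>n. euler_square_coeff S n - (if p dvd n then euler_square_coeff S (n div p) else 0))"
  shows "euler_square_coeff (insert p S) n = b n - (if p dvd n then b (n div p) else 0)"
proof -
  have p0: "p > 0" using p prime_gt_0_nat by blast
  have cop: "coprime p (q ^ k)" if "q \<in> S" for q k
    using that p S by (intro coprime_power_right_iff[THEN iffD2] disjI1 primes_coprime) auto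
  have dv: "q ^ k dvd p * m \<longleftrightarrow> q ^ k dvd m" if "q \<in> S" for q k m
    using coprime_dvd_mult_right_iff[of "q ^ k" p m] cop[OF that] by (simp add: coprime_commute)
  have inv: "euler_square_coeff S (p * m) = euler_square_coeff S m" for m
  proof -
    have "{q \<in> S. q dvd p * m} = {q \<in> S. q dvd m}" using dv[where k = 1] by auto
    moreover have "(\<exists>q\<in>S. q\<^sup>2 dvd p * m) \<longleftrightarrow> (\<exists>q\<in>S. q\<^sup>2 dvd m)" using dv[where k = 2] by auto
    ultimately show ?thesis unfolding euler_square_coeff_def by simp
  qed
  have b: "b n = (if p dvd n then 0 else euler_square_coeff S n)" for n
    unfolding b_def using inv p0 by auto
  show ?thesis
  proof (cases "p dvd n")
    case False
    then have "\<not> p\<^sup>2 dvd n" by (meson dvd_trans dvd_power_same le_refl dvd_triv_left power2_eq_square dvd_power zero_less_numeral)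
    moreover have "{q \<in> insert p S. q dvd n} = {q \<in> S. q dvd n}" using False by auto
    ultimately show ?thesis using False by (simp add: b euler_square_coeff_def)
  next
    case True
    then obtain m where m: "n = p * m" by blast
    have sq: "p\<^sup>2 dvd n \<longleftrightarrow> p dvd m" using p0 by (simp add: m power2_eq_square)
    have "card {q \<in> insert p S. q dvd n} = Suc (card {q \<in> S. q dvd n})"
    proof -
      have "{q \<in> insert p S. q dvd n} = insert p {q \<in> S. q dvd n}" using True by auto
      then show ?thesis using p S by simp
    qed
    then have "euler_square_coeff (insert p S) n = (if p dvd m then 0 else - euler_square_coeff S n)"
      using sq by (simp add: euler_square_coeff_def)
    then show ?thesis using True p0 inv by (simp add: b m)
  qed
qed

lemma error_transform_euler_square:
  assumes "finite S" "\<And>p. p \<in> S \<Longrightarrow> prime p" "error_transform (\<lambda>_. 1) 1 Z"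
  shows "\<exists>c. error_transform (euler_square_coeff S) c
     (\<lambda>s. Z s * (\<Prod>p\<in>S. 1 - exp (- (s * ln (real p))))\<^sup>2)"
  using assms(1,2)
proof (induction S rule: finite_induct)
  case empty
  have "euler_square_coeff {} = (\<lambda>_. 1)" by (auto simp: euler_square_coeff_def)
  then show ?case using assms(3) by auto
next
  case (insert p S)
  then obtain c where c: "error_transform (euler_square_coeff S) c
     (\<lambda>s. Z s * (\<Prod>p\<in>S. 1 - exp (- (s * ln (real p))))\<^sup>2)" by auto
  have p: "p > 0" "prime p" using insert.prems prime_gt_0_nat by auto
  let ?b = "\<lambda>n. euler_square_coeff S n - (if p dvd n then euler_square_coeff S (n div p) else 0)"
  let ?c = "(c - c / real p) - (c - c / real p) / real p"
  have "error_transform (\<lambda>n. ?b n - (if p dvd n then ?b (n div p) else 0)) ?c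
    (\<lambda>s. Z s * (\<Prod>p\<in>S. 1 - exp (- (s * ln (real p))))\<^sup>2 * (1 - exp (- (s * ln (real p)))) * (1 - exp (- (s * ln (real p)))))"
    by (rule error_transform_euler_factor[OF error_transform_euler_factor[OF c p(1)] p(1)])
  also have "(\<lambda>n. ?b n - (if p dvd n then ?b (n div p) else 0)) = euler_square_coeff (insert p S)"
    by (rule ext, rule euler_square_coeff_insert[symmetric]) (use insert p in auto)
  also have "(\<lambda>s. Z s * (\<Prod>p\<in>S. 1 - exp (- (s * ln (real p))))\<^sup>2 * (1 - exp (- (s * ln (real p)))) * (1 - exp (- (s * ln (real p))))) =
     (\<lambda>s. Z s * (\<Prod>p\<in>insert p S. 1 - exp (- (s * ln (real p))))\<^sup>2)"
    using insert.hyps by (simp add: power2_eq_square mult_ac)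
  finally show ?case by blast
qed

section \<open>Mean squares in the critical strip\<close>

text \<open>
  From the Taylor bound \<open>|exp z - 1 - z| \<le> 2 |z|\<^sup>2\<close>.
\<close>

lemma norm_exp_minus_one_ge:
  fixes z :: complex
  assumes "norm z \<le> 1 / 4"
  shows "norm z / 2 \<le> norm (exp z - 1)"
proof -
  have "norm (exp z - (\<Sum>k\<le>1. z ^ k / fact k)) \<le> exp \<bar>Re z\<bar> * norm z ^ Suc 1 / fact 1"
    by (rule Taylor_exp)
  moreover have "exp \<bar>Re z\<bar> \<le> 2"
    using real_exp_bound_lemma[of "\<bar>Re z\<bar>"] abs_Re_le_cmod[of z] assms by simp
  then have "exp \<bar>Re z\<bar> * (norm z ^ Suc 1) \<le> 2 * (norm z ^ Suc 1)"
    by (rule mult_right_mono) simp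
  ultimately have "norm (exp z - 1 - z) \<le> 2 * (norm z)\<^sup>2"
    by (simp add: diff_diff_eq power2_eq_square)
  also have "\<dots> \<le> norm z / 2"
    using mult_right_mono[OF assms, of "norm z"] by (simp add: power2_eq_square)
  finally show ?thesis using norm_triangle_ineq2[of z "z - (exp z - 1)"]
    by (simp add: norm_minus_commute algebra_simps)
qed

text \<open>
  For \<open>e\<^sup>u < X\<close> the interval from \<open>e\<^sup>u\<close> to \<open>e\<^sup>u\<^sup>+\<^sup>\<eta>\<close> is shorter than \<open>1\<close> and contains at most one
  integer, so the square of the sum of coefficients is the sum of their squares. No off-diagonal
  terms arise.
\<close>

lemma short_interval_bound:
  fixes a :: "nat \<Rightarrow> real"
  assumes X: "X \<ge> 2" and \<eta>: "0 < \<eta>" "exp \<eta> - 1 \<le> 1 / X" and u: "u < ln X"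
  shows "(summatory_error a c (u + \<eta>) - summatory_error a c u)\<^sup>2 \<le>
    2 * (\<Sum>n=1..nat \<lfloor>2 * X\<rfloor>. (a n)\<^sup>2 * indicator {ln (real n) - \<eta>..ln (real n)} u) + 2 * c\<^sup>2 / X\<^sup>2 * exp (2 * u)"
proof -
  define d where "d = exp (u + \<eta>) - exp u"
  define m n where "m = nat \<lfloor>exp u\<rfloor>" and "n = nat \<lfloor>exp (u + \<eta>)\<rfloor>"
  have eu: "exp u < X" using u X by (metis exp_less_cancel_iff exp_ln less_le_trans zero_less_numeral)
  have d0: "d \<ge> 0" using \<eta> by (simp add: d_def)
  have "d = exp u * (exp \<eta> - 1)" by (simp add: d_def exp_add algebra_simps)
  also have "\<dots> \<le> exp u * (1 / X)" by (intro mult_left_mono \<eta>) simp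
  finally have d: "d \<le> exp u / X" by simp
  then have d1: "d < 1" using eu X by (smt (verit) divide_less_eq_1_pos)
  have dsq: "d\<^sup>2 \<le> exp (2 * u) / X\<^sup>2"
    using power_mono[OF d d0, of 2] by (simp add: power_divide exp_double)
  define s where "s = (\<Sum>k=1..n. a k) - (\<Sum>k=1..m. a k)"
  have eq: "summatory_error a c (u + \<eta>) - summatory_error a c u = s - c * d"
    by (simp add: summatory_error_def s_def d_def m_def n_def algebra_simps)
  have nn: "0 \<le> (\<Sum>n=1..nat \<lfloor>2 * X\<rfloor>. (a n)\<^sup>2 * indicator {ln (real n) - \<eta>..ln (real n)} u)"
    by (intro sum_nonneg) auto
  have fl: "\<lfloor>exp u\<rfloor> \<le> \<lfloor>exp (u + \<eta>)\<rfloor>" "\<lfloor>exp (u + \<eta>)\<rfloor> \<le> \<lfloor>exp u\<rfloor> + 1" "\<lfloor>exp u\<rfloor> \<ge> 0"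
    using d0 d1 unfolding d_def by (auto intro: floor_mono) linarith
  then have "n = m \<or> n = Suc m" unfolding m_def n_def by linarith
  then have s2: "s\<^sup>2 \<le> (\<Sum>n=1..nat \<lfloor>2 * X\<rfloor>. (a n)\<^sup>2 * indicator {ln (real n) - \<eta>..ln (real n)} u)"
  proof
    assume "n = m"
    then show ?thesis using nn by (simp add: s_def)
  next
    assume nm: "n = Suc m"
    then have s: "s = a n" by (simp add: s_def)
    have "real n = of_int \<lfloor>exp (u + \<eta>)\<rfloor>" "real m = of_int \<lfloor>exp u\<rfloor>"
      unfolding n_def m_def using fl by simp_all
    then have "real n \<le> exp (u + \<eta>)" "exp u < real n" using nm by linarith+
    then have "ln (real n) \<le> u + \<eta>" "u < ln (real n)"
      using nm by (metis exp_gt_zero ln_exp ln_le_cancel_iff of_nat_0_less_iff zero_less_Suc,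
                   metis exp_gt_zero ln_exp ln_less_cancel_iff of_nat_0_less_iff zero_less_Suc)
    then have i: "indicator {ln (real n) - \<eta>..ln (real n)} u = (1::real)" by simp
    have "real n \<le> 2 * X" using \<open>real n \<le> exp (u + \<eta>)\<close> d1 eu X unfolding d_def by linarith
    then have "n \<le> nat \<lfloor>2 * X\<rfloor>" by linarith
    then have "n \<in> {1..nat \<lfloor>2 * X\<rfloor>}" using nm by simp
    from member_le_sum[OF this, of "\<lambda>n. (a n)\<^sup>2 * indicator {ln (real n) - \<eta>..ln (real n)} u"]
    show ?thesis unfolding s by (simp add: i)
  qed
  have "(s - c * d)\<^sup>2 \<le> 2 * s\<^sup>2 + 2 * c\<^sup>2 * d\<^sup>2"
    using zero_le_power2[of "s + c * d"] by (simp add: power2_eq_square algebra_simps)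
  also have "\<dots> \<le> 2 * (\<Sum>n=1..nat \<lfloor>2 * X\<rfloor>. (a n)\<^sup>2 * indicator {ln (real n) - \<eta>..ln (real n)} u) + 2 * c\<^sup>2 * (exp (2 * u) / X\<^sup>2)"
    by (intro add_mono mult_left_mono s2 dsq) auto
  finally show ?thesis unfolding eq by simp
qed

text \<open>
  The three terms of the pointwise bound in the proof are the single integer in the interval, the
  main term \<open>c (e\<^sup>u\<^sup>+\<^sup>\<eta> - e\<^sup>u)\<close>, and the trivial bound beyond \<open>ln X\<close>.
\<close>

lemma short_interval_mean_square:
  fixes a :: "nat \<Rightarrow> real" and x B :: real
  assumes B: "\<And>u. \<bar>summatory_error a c u\<bar> \<le> B" and x: "0 < x" "x < 1"
    and X: "X \<ge> 2" and \<eta>: "\<eta> = 1 / (4 * X)"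
  shows "(\<integral>\<^sup>+u. ennreal (((summatory_error a c (u + \<eta>) - summatory_error a c u) * exp (- (x * u)))\<^sup>2) \<partial>lborel)
    \<le> ennreal (1 / X * (\<Sum>n=1..nat \<lfloor>2 * X\<rfloor>. (a n)\<^sup>2 * real n powr (- (2 * x))) + (c\<^sup>2 / (1 - x) + 2 * B\<^sup>2 / x) * X powr (- (2 * x)))"
proof -
  let ?D = "\<lambda>u. summatory_error a c (u + \<eta>) - summatory_error a c u"
  let ?N = "nat \<lfloor>2 * X\<rfloor>"
  have \<eta>0: "0 < \<eta>" "\<eta> \<le> 1/8" using X unfolding \<eta> by (auto simp: field_simps)
  have "exp \<eta> - 1 \<le> 2 * \<eta>" using real_exp_bound_lemma[of \<eta>] \<eta>0 by simp
  also have "\<dots> \<le> 1 / X" using X by (simp add: \<eta> field_simps)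
  finally have \<eta>X: "exp \<eta> - 1 \<le> 1 / X" .
  have pt: "ennreal ((?D u * exp (- (x * u)))\<^sup>2) \<le>
     (\<Sum>n=1..?N. ennreal (4 * (a n)\<^sup>2 * real n powr (- (2 * x))) * indicator {ln (real n) - \<eta>..ln (real n)} u) +
     (ennreal (2 * c\<^sup>2 / X\<^sup>2) * (ennreal (exp ((2 - 2 * x) * u)) * indicator {..ln X} u) +
     ennreal (4 * B\<^sup>2) * (ennreal (exp (- (2 * x * u))) * indicator {ln X..} u))" (is "_ \<le> ?S1 u + (?S2 u + ?S3 u)") for u
  proof -
    have sq: "(?D u * exp (- (x * u)))\<^sup>2 = (?D u)\<^sup>2 * exp (- (2 * x * u))"
      by (simp add: power_mult_distrib exp_double[symmetric])
    show ?thesis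
    proof (cases "u < ln X")
      case True
      have t: "(a n)\<^sup>2 * indicator {ln (real n) - \<eta>..ln (real n)} u * (2 * exp (- (2 * x * u))) \<le>
          4 * (a n)\<^sup>2 * real n powr (- (2 * x)) * indicator {ln (real n) - \<eta>..ln (real n)} u" if "n \<in> {1..?N}" for n
      proof (cases "u \<in> {ln (real n) - \<eta>..ln (real n)}")
        case True
        have "2 * x * \<eta> \<le> 2 * 1 * (1/8)" using x \<eta>0 by (intro mult_mono) auto
        then have e: "exp (2 * x * \<eta>) \<le> 2" using real_exp_bound_lemma[of "2 * x * \<eta>"] x \<eta>0 by simp
        have "2 * x * (ln (real n) - \<eta>) \<le> 2 * x * u" using x True by (intro mult_left_mono) auto
        then have "exp (- (2 * x * u)) \<le> exp (2 * x * \<eta> + (- (2 * x)) * ln (real n))" by (simp add: algebra_simps)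
        also have "\<dots> = exp (2 * x * \<eta>) * real n powr (- (2 * x))"
          using that by (simp only: exp_add powr_def) simp
        also have "\<dots> \<le> 2 * real n powr (- (2 * x))" by (intro mult_right_mono e) simp
        finally have "(a n)\<^sup>2 * (2 * exp (- (2 * x * u))) \<le> (a n)\<^sup>2 * (2 * (2 * real n powr (- (2 * x))))"
          by (intro mult_left_mono) auto
        then show ?thesis using True by simp
      qed simp
      have alg: "(2 * S + k * e) * w = S * (2 * w) + k * (e * w)" for S k e w :: real
        by (simp add: algebra_simps)
      have "(?D u)\<^sup>2 * exp (- (2 * x * u)) \<le>
        (2 * (\<Sum>n=1..?N. (a n)\<^sup>2 * indicator {ln (real n) - \<eta>..ln (real n)} u) + 2 * c\<^sup>2 / X\<^sup>2 * exp (2 * u)) * exp (- (2 * x * u))"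
        by (intro mult_right_mono short_interval_bound X \<eta>0 \<eta>X True) simp
      also have "\<dots> = (\<Sum>n=1..?N. (a n)\<^sup>2 * indicator {ln (real n) - \<eta>..ln (real n)} u * (2 * exp (- (2 * x * u))))
          + 2 * c\<^sup>2 / X\<^sup>2 * (exp (2 * u) * exp (- (2 * x * u)))"
        unfolding sum_distrib_right[symmetric] by (rule alg)
      also have "exp (2 * u) * exp (- (2 * x * u)) = exp ((2 - 2 * x) * u)"
        by (simp add: exp_add[symmetric] algebra_simps)
      also have "(\<Sum>n=1..?N. (a n)\<^sup>2 * indicator {ln (real n) - \<eta>..ln (real n)} u * (2 * exp (- (2 * x * u)))) \<le>
         (\<Sum>n=1..?N. 4 * (a n)\<^sup>2 * real n powr (- (2 * x)) * indicator {ln (real n) - \<eta>..ln (real n)} u)"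
        by (intro sum_mono t)
      finally have "ennreal ((?D u)\<^sup>2 * exp (- (2 * x * u))) \<le>
         ennreal ((\<Sum>n=1..?N. 4 * (a n)\<^sup>2 * real n powr (- (2 * x)) * indicator {ln (real n) - \<eta>..ln (real n)} u)
          + 2 * c\<^sup>2 / X\<^sup>2 * exp ((2 - 2 * x) * u))"
        by (intro ennreal_leI) simp
      also have "\<dots> = ?S1 u + ?S2 u"
      proof -
        have "ennreal (\<Sum>n=1..?N. 4 * (a n)\<^sup>2 * real n powr (- (2 * x)) * indicator {ln (real n) - \<eta>..ln (real n)} u) =
          (\<Sum>n=1..?N. ennreal (4 * (a n)\<^sup>2 * real n powr (- (2 * x)) * indicator {ln (real n) - \<eta>..ln (real n)} u))"
          by (rule sum_ennreal[symmetric]) simp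
        also have "\<dots> = ?S1 u"
          by (intro sum.cong refl) (simp split: split_indicator)
        finally have "ennreal (\<Sum>n=1..?N. 4 * (a n)\<^sup>2 * real n powr (- (2 * x)) * indicator {ln (real n) - \<eta>..ln (real n)} u) = ?S1 u" .
        moreover have "ennreal (2 * c\<^sup>2 / X\<^sup>2 * exp ((2 - 2 * x) * u)) = ?S2 u"
          using True ennreal_mult[of "2 * c\<^sup>2 / X\<^sup>2" "exp ((2 - 2 * x) * u)"] by simp
        ultimately show ?thesis
          by (subst ennreal_plus) (auto intro!: sum_nonneg)
      qed
      also have "\<dots> \<le> ?S1 u + (?S2 u + ?S3 u)" by (intro add_left_mono) simp
      finally show ?thesis unfolding sq .
    next
      case False
      have "\<bar>?D u\<bar> \<le> 2 * B" using B[of u] B[of "u + \<eta>"] by linarith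
      then have "(?D u)\<^sup>2 \<le> (2 * B)\<^sup>2" by (metis abs_ge_zero power2_abs power_mono)
      then have "(?D u)\<^sup>2 * exp (- (2 * x * u)) \<le> 4 * B\<^sup>2 * exp (- (2 * x * u))"
        by (intro mult_right_mono) (auto simp: power_mult_distrib)
      then have "ennreal ((?D u)\<^sup>2 * exp (- (2 * x * u))) \<le> ?S3 u"
        using False by (auto simp: ennreal_mult[symmetric] intro!: ennreal_leI)
      also have "\<dots> \<le> ?S1 u + (?S2 u + ?S3 u)" by (simp add: add_increasing)
      finally show ?thesis unfolding sq .
    qed
  qed
  have "(\<integral>\<^sup>+u. ennreal ((?D u * exp (- (x * u)))\<^sup>2) \<partial>lborel) \<le> (\<integral>\<^sup>+u. ?S1 u + (?S2 u + ?S3 u) \<partial>lborel)"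
    by (rule nn_integral_mono[OF pt])
  also have "\<dots> = (\<integral>\<^sup>+u. ?S1 u \<partial>lborel) + ((\<integral>\<^sup>+u. ?S2 u \<partial>lborel) + (\<integral>\<^sup>+u. ?S3 u \<partial>lborel))"
    by (subst nn_integral_add, measurable, subst nn_integral_add, measurable)
  also have "(\<integral>\<^sup>+u. ?S1 u \<partial>lborel) = ennreal (1 / X * (\<Sum>n=1..?N. (a n)\<^sup>2 * real n powr (- (2 * x))))"
  proof -
    have "(\<integral>\<^sup>+u. ?S1 u \<partial>lborel) = (\<Sum>n=1..?N. ennreal (4 * (a n)\<^sup>2 * real n powr (- (2 * x))) * ennreal \<eta>)"
    proof (subst nn_integral_sum, measurable, intro sum.cong refl)
      fix n
      show "(\<integral>\<^sup>+u. ennreal (4 * (a n)\<^sup>2 * real n powr (- (2 * x))) * indicator {ln (real n) - \<eta>..ln (real n)} u \<partial>lborel)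
          = ennreal (4 * (a n)\<^sup>2 * real n powr (- (2 * x))) * ennreal \<eta>"
        using \<eta>0 by (subst nn_integral_cmult_indicator) auto
    qed
    also have "\<dots> = ennreal (\<Sum>n=1..?N. 4 * (a n)\<^sup>2 * real n powr (- (2 * x)) * \<eta>)"
      using \<eta>0 by (subst sum_ennreal[symmetric]) (auto simp: ennreal_mult)
    also have "(\<Sum>n=1..?N. 4 * (a n)\<^sup>2 * real n powr (- (2 * x)) * \<eta>) = 1 / X * (\<Sum>n=1..?N. (a n)\<^sup>2 * real n powr (- (2 * x)))"
      unfolding sum_distrib_left using X by (intro sum.cong refl) (simp add: \<eta>)
    finally show ?thesis .
  qed
  also have "(\<integral>\<^sup>+u. ?S2 u \<partial>lborel) = ennreal (c\<^sup>2 / (1 - x) * X powr (- (2 * x)))"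
  proof -
    have "(\<integral>\<^sup>+u. ?S2 u \<partial>lborel) = ennreal (2 * c\<^sup>2 / X\<^sup>2) * ennreal (exp ((2 - 2 * x) * ln X) / (2 - 2 * x))"
      using x by (subst nn_integral_cmult) (auto simp: nn_integral_exp_atMost)
    also have "\<dots> = ennreal (2 * c\<^sup>2 / X\<^sup>2 * (exp ((2 - 2 * x) * ln X) / (2 - 2 * x)))"
      using x by (subst ennreal_mult) auto
    also have "exp ((2 - 2 * x) * ln X) = X\<^sup>2 * X powr (- (2 * x))"
    proof -
      have "exp ((2 - 2 * x) * ln X) = X powr (2 + (- (2 * x)))" using X by (simp add: powr_def)
      also have "\<dots> = X\<^sup>2 * X powr (- (2 * x))" using X by (subst powr_add) simp
      finally show ?thesis .
    qed
    also have "2 * c\<^sup>2 / X\<^sup>2 * (X\<^sup>2 * X powr (- (2 * x)) / (2 - 2 * x)) = c\<^sup>2 / (1 - x) * X powr (- (2 * x))"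
      using X x by (simp add: field_simps)
    finally show ?thesis .
  qed
  also have "(\<integral>\<^sup>+u. ?S3 u \<partial>lborel) = ennreal (2 * B\<^sup>2 / x * X powr (- (2 * x)))"
  proof -
    have "(\<integral>\<^sup>+u. ?S3 u \<partial>lborel) = ennreal (4 * B\<^sup>2) * ennreal (exp (- (2 * x * ln X)) / (2 * x))"
      using x by (subst nn_integral_cmult) (auto simp: nn_integral_exp_atLeast)
    also have "\<dots> = ennreal (4 * B\<^sup>2 * (exp (- (2 * x * ln X)) / (2 * x)))"
      using x by (subst ennreal_mult) auto
    also have "exp (- (2 * x * ln X)) = X powr (- (2 * x))" using X by (simp add: powr_def)
    finally show ?thesis using x by (simp add: field_simps)
  qed
  also have "ennreal (1 / X * (\<Sum>n=1..?N. (a n)\<^sup>2 * real n powr (- (2 * x)))) +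
     (ennreal (c\<^sup>2 / (1 - x) * X powr (- (2 * x))) + ennreal (2 * B\<^sup>2 / x * X powr (- (2 * x)))) =
     ennreal (1 / X * (\<Sum>n=1..?N. (a n)\<^sup>2 * real n powr (- (2 * x))) + (c\<^sup>2 / (1 - x) * X powr (- (2 * x)) + 2 * B\<^sup>2 / x * X powr (- (2 * x))))"
    using x X by (subst ennreal_plus[symmetric], simp, simp, subst ennreal_plus[symmetric]) (auto intro!: sum_nonneg divide_nonneg_nonneg)
  finally show ?thesis by (simp only: distrib_right)
qed

text \<open>
  With \<open>\<eta> = 1 / (4 X)\<close> the factor \<open>(e\<^sup>\<eta>\<^sup>s - 1) / s\<close> has modulus at least \<open>\<eta> / 2\<close> for \<open>|Im s| \<le> X - 1\<close>.
  The second term of the bound is \<open>o(X)\<close> exactly when \<open>x > 1/2\<close>.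
\<close>

lemma mean_square_upper_bound:
  fixes a :: "nat \<Rightarrow> real" and x :: real
  assumes E: "error_transform a c Z" and x: "0 < x" "x < 1"
  obtains K where "K \<ge> 0" "\<And>X. X \<ge> 2 \<Longrightarrow>
     (\<integral>\<^sup>+t\<in>{-(X - 1)..X - 1}. ennreal ((norm (Z (Complex x t)))\<^sup>2) \<partial>lborel) \<le>
     ennreal (1024 * X * (\<Sum>n=1..nat \<lfloor>2 * X\<rfloor>. (a n)\<^sup>2 * real n powr (- (2 * x))) + K * X powr (2 - 2 * x))"
proof -
  obtain B where B: "\<forall>u. \<bar>summatory_error a c u\<bar> \<le> B * min 1 (exp u)"
    using E unfolding error_transform_def by blast
  have B0: "B \<ge> 0" using B[rule_format, of 0] by simp
  have B': "\<bar>summatory_error a c u\<bar> \<le> B" for u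
    using B[rule_format, of u] mult_left_mono[OF min.cobounded1[of 1 "exp u"] B0] by simp
  define K where "K = 1024 * (c\<^sup>2 / (1 - x) + 2 * B\<^sup>2 / x)"
  have K0: "K \<ge> 0" using x by (simp add: K_def)
  have main: "(\<integral>\<^sup>+t\<in>{-(X - 1)..X - 1}. ennreal ((norm (Z (Complex x t)))\<^sup>2) \<partial>lborel) \<le>
     ennreal (1024 * X * (\<Sum>n=1..nat \<lfloor>2 * X\<rfloor>. (a n)\<^sup>2 * real n powr (- (2 * x))) + K * X powr (2 - 2 * x))"
    if X: "X \<ge> 2" for X
  proof -
    define \<eta> where "\<eta> = 1 / (4 * X)"
    have \<eta>0: "\<eta> > 0" using X by (simp add: \<eta>_def)
    define f where "f = (\<lambda>u. (summatory_error a c (u + \<eta>) - summatory_error a c u) * exp (- (x * u)))"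
    have [measurable]: "f \<in> borel_measurable borel" unfolding f_def by measurable
    define bd where "bd = 1 / X * (\<Sum>n=1..nat \<lfloor>2 * X\<rfloor>. (a n)\<^sup>2 * real n powr (- (2 * x))) + (c\<^sup>2 / (1 - x) + 2 * B\<^sup>2 / x) * X powr (- (2 * x))"
    have f2: "(\<integral>\<^sup>+u. ennreal ((f u)\<^sup>2) \<partial>lborel) \<le> ennreal bd"
      unfolding f_def bd_def by (rule short_interval_mean_square[OF B' x X \<eta>_def])
    have bd0: "bd \<ge> 0" unfolding bd_def using X x by (intro add_nonneg_nonneg mult_nonneg_nonneg sum_nonneg) auto
    have if2: "integrable lborel (\<lambda>u. (f u)\<^sup>2)"
      by (rule integrableI_bounded) (auto intro: le_less_trans[OF f2])
    have "ennreal (LINT u|lborel. (f u)\<^sup>2) \<le> ennreal bd"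
      using f2 by (subst nn_integral_eq_integral[symmetric, OF if2]) auto
    then have f2': "(LINT u|lborel. (f u)\<^sup>2) \<le> bd" using bd0 by simp
    have tr: "integrable lborel (\<lambda>u. complex_of_real (f u) * iexp (- (t * u))) \<and>
        (CLINT u|lborel. complex_of_real (f u) * iexp (- (t * u))) =
          (exp (Complex x t * \<eta>) - 1) * (Z (Complex x t) / Complex x t)" for t
    proof -
      define s where "s = Complex x t"
      have s: "0 < Re s" "Re s < 1" using x by (auto simp: s_def)
      let ?g = "\<lambda>u. complex_of_real (summatory_error a c u) * exp (- (s * u))"
      have g: "integrable lborel ?g" by (rule integrable_summatory_error[OF B s])
      have gs: "complex_of_real (f u) * iexp (- (t * u)) = exp (s * \<eta>) * ?g (\<eta> + 1 * u) - ?g u" for u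
      proof -
        have "complex_of_real (exp (- (x * u))) * iexp (- (t * u)) = exp (- (s * u))"
          by (simp add: exp_of_real[symmetric] exp_add[symmetric] s_def Complex_eq algebra_simps)
        then have 1: "complex_of_real (f u) * iexp (- (t * u)) =
          complex_of_real (summatory_error a c (u + \<eta>)) * exp (- (s * u)) - complex_of_real (summatory_error a c u) * exp (- (s * u))"
          by (simp add: f_def algebra_simps)
        have "exp (- (s * u)) = exp (s * \<eta>) * exp (- (s * complex_of_real (\<eta> + 1 * u)))"
          by (simp add: exp_add[symmetric] algebra_simps)
        then have "complex_of_real (summatory_error a c (u + \<eta>)) * exp (- (s * u)) = exp (s * \<eta>) * ?g (\<eta> + 1 * u)"
          by (simp add: add.commute)
        with 1 show ?thesis by simp
      qed
      have gi: "integrable lborel (\<lambda>u. ?g (\<eta> + 1 * u))"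
        by (rule lborel_integrable_real_affine[OF g]) simp
      have "(CLINT u|lborel. ?g (\<eta> + 1 * u)) = (CLINT u|lborel. ?g u)"
        using lborel_integral_real_affine[of 1 ?g \<eta>] by simp
      then have "(CLINT u|lborel. exp (s * \<eta>) * ?g (\<eta> + 1 * u) - ?g u) =
         exp (s * \<eta>) * (CLINT u|lborel. ?g u) - (CLINT u|lborel. ?g u)"
        using g gi by (simp only: Bochner_Integration.integral_diff integrable_mult_right integral_mult_right_zero)
      moreover have "(CLINT u|lborel. ?g u) = Z s / s" using E s unfolding error_transform_def by blast
      moreover have "integrable lborel (\<lambda>u. exp (s * \<eta>) * ?g (\<eta> + 1 * u) - ?g u)"
        using g gi by (intro Bochner_Integration.integrable_diff integrable_mult_right)
      ultimately show ?thesis unfolding gs s_def[symmetric] by (simp add: left_diff_distrib diff_divide_distrib)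
    qed
    have if1: "integrable lborel f"
      using tr[of 0] by (simp add: complex_of_real_integrable_eq)
    define F where "F = (\<lambda>t. CLINT u|lborel. complex_of_real (f u) * iexp (- (t * u)))"
    have ZF: "(norm (Z (Complex x t)))\<^sup>2 \<le> 64 * X\<^sup>2 * (norm (F t))\<^sup>2" if t: "t \<in> {-(X - 1)..X - 1}" for t
    proof -
      define s where "s = Complex x t"
      have s0: "norm s > 0" using x by (auto simp: s_def complex_eq_iff)
      have "norm s \<le> \<bar>Re s\<bar> + \<bar>Im s\<bar>" by (rule cmod_le)
      also have "\<dots> \<le> X" using t x by (auto simp: s_def)
      finally have "norm (s * \<eta>) \<le> X * \<eta>" using \<eta>0 by (simp add: norm_mult)
      also have "\<dots> = 1 / 4" using X by (simp add: \<eta>_def)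
      finally have "norm (s * \<eta>) / 2 \<le> norm (exp (s * \<eta>) - 1)" by (rule norm_exp_minus_one_ge)
      then have "norm s * \<eta> / 2 * (norm (Z s) / norm s) \<le> norm (exp (s * \<eta>) - 1) * (norm (Z s) / norm s)"
        using \<eta>0 by (intro mult_right_mono) (auto simp: norm_mult)
      also have "\<dots> = norm (F t)" using tr[of t] unfolding F_def s_def by (simp add: norm_mult norm_divide)
      finally have "\<eta> / 2 * norm (Z s) \<le> norm (F t)" using s0 by (simp add: mult.commute)
      then have "norm (Z s) \<le> 8 * X * norm (F t)" using X by (simp add: \<eta>_def field_simps)
      then have "(norm (Z s))\<^sup>2 \<le> (8 * X * norm (F t))\<^sup>2" by (rule power_mono) simp
      then show ?thesis by (simp add: s_def power_mult_distrib)
    qed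
    have pi16: "2 * pi * exp (1 / 2) \<le> 16"
    proof -
      have "exp (1 / 2 :: real) \<le> 2" using real_exp_bound_lemma[of "1/2"] by simp
      then have "2 * pi * exp (1 / 2) \<le> 2 * 4 * 2" using pi_less_4 by (intro mult_mono) auto
      then show ?thesis by simp
    qed
    have "(\<integral>\<^sup>+t\<in>{-(X - 1)..X - 1}. ennreal ((norm (Z (Complex x t)))\<^sup>2) \<partial>lborel) \<le>
      (\<integral>\<^sup>+t. ennreal (64 * X\<^sup>2) * (ennreal ((norm (F t))\<^sup>2) * indicator {-(X - 1)..X - 1} t) \<partial>lborel)"
      by (intro nn_integral_mono) (auto split: split_indicator simp: ennreal_mult[symmetric] intro!: ennreal_leI ZF)
    also have "\<dots> = ennreal (64 * X\<^sup>2) * (\<integral>\<^sup>+t\<in>{-(X - 1)..X - 1}. ennreal ((norm (F t))\<^sup>2) \<partial>lborel)"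
      unfolding F_def by (rule nn_integral_cmult) measurable
    also have "\<dots> \<le> ennreal (64 * X\<^sup>2) * ennreal (2 * pi * exp (1/2) * (LINT u|lborel. (f u)\<^sup>2))"
      unfolding F_def using X by (intro mult_left_mono bessel_inequality_fourier if1 if2) auto
    also have "\<dots> \<le> ennreal (64 * X\<^sup>2) * ennreal (16 * bd)"
      by (intro mult_left_mono ennreal_leI mult_mono pi16 f2') auto
    also have "\<dots> = ennreal (64 * X\<^sup>2 * (16 * bd))" using bd0 by (subst ennreal_mult) auto
    also have "64 * X\<^sup>2 * (16 * bd) = 1024 * X * (\<Sum>n=1..nat \<lfloor>2 * X\<rfloor>. (a n)\<^sup>2 * real n powr (- (2 * x))) + K * (X\<^sup>2 * X powr (- (2 * x)))"
      using X by (simp add: bd_def K_def power2_eq_square algebra_simps)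
    also have "X\<^sup>2 * X powr (- (2 * x)) = X powr (2 + (- (2 * x)))" using X by (subst powr_add) simp
    finally show ?thesis by simp
  qed
  show ?thesis by (rule that[OF K0 main])
qed

section \<open>Mean squares of finite Euler products\<close>

text \<open>
  The frequencies are distinct, so only the diagonal terms survive in the mean.
\<close>

lemma mean_square_exponential_sum:
  fixes c :: "'i \<Rightarrow> complex" and w :: "'i \<Rightarrow> real"
  assumes I: "finite I" "I \<noteq> {}" and w: "inj_on w I"
  defines "f \<equiv> (\<lambda>t. \<Sum>i\<in>I. c i * exp (\<i> * of_real t * of_real (w i)))"
  shows "((\<lambda>T. 1 / T * integral {0..T} (\<lambda>t. (norm (f t))\<^sup>2)) \<longlongrightarrow> (\<Sum>i\<in>I. (norm (c i))\<^sup>2)) at_top"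
proof -
  obtain h where h: "bij_betw h {0..<card I} I" using ex_bij_betw_nat_finite[OF I(1)] by blast
  define N where "N = card I - 1"
  have "card I > 0" using I by (simp add: card_gt_0_iff)
  then have "{0..<card I} = {..N}" by (auto simp: N_def)
  then have h: "bij_betw h {..N} I" using h by simp
  have fh: "f t = (\<Sum>r\<le>N. c (h r) * exp (\<i> * of_real t * of_real (w (h r))))" for t
    unfolding f_def by (rule sum.reindex_bij_betw[OF h, symmetric])
  have inj: "inj_on (\<lambda>r. w (h r)) {..N}"
    using comp_inj_on[OF bij_betw_imp_inj_on[OF h], of w] w bij_betw_imp_surj_on[OF h] by (simp add: o_def)
  have 1: "((\<lambda>T. (1 / T) * integral {0..T} (\<lambda>t. f t * exp (- \<i> * of_real t * of_real (w (h k))))) \<longlongrightarrow> c (h k)) at_top"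
    if "k \<le> N" for k
    unfolding fh by (rule Kronecker_simult_aux1[OF inj that])
  have sq: "complex_of_real ((norm (f t))\<^sup>2) = (\<Sum>k\<le>N. cnj (c (h k)) * (f t * exp (- \<i> * of_real t * of_real (w (h k)))))" for t
  proof -
    have "cnj (f t) = (\<Sum>k\<le>N. cnj (c (h k)) * exp (- \<i> * of_real t * of_real (w (h k))))"
      unfolding fh by (simp add: exp_cnj)
    then show ?thesis by (simp only: complex_norm_square sum_distrib_left) (simp only: mult_ac)
  qed
  have cont: "continuous_on A f" for A
    unfolding f_def by (intro continuous_intros)
  have 2: "complex_of_real (1 / T * integral {0..T} (\<lambda>t. (norm (f t))\<^sup>2)) =
      (\<Sum>k\<le>N. cnj (c (h k)) * ((1 / T) * integral {0..T} (\<lambda>t. f t * exp (- \<i> * of_real t * of_real (w (h k))))))" for T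
  proof -
    define J where "J = (\<lambda>k. integral {0..T} (\<lambda>t. f t * exp (- \<i> * of_real t * of_real (w (h k)))))"
    have "complex_of_real (integral {0..T} (\<lambda>t. (norm (f t))\<^sup>2)) = integral {0..T} (\<lambda>t. complex_of_real ((norm (f t))\<^sup>2))"
      by (rule integral_unique[symmetric], rule has_integral_of_real, rule integrable_integral)
         (auto intro!: integrable_continuous_interval continuous_intros cont)
    also have "\<dots> = (\<Sum>k\<le>N. integral {0..T} (\<lambda>t. cnj (c (h k)) * (f t * exp (- \<i> * of_real t * of_real (w (h k))))))"
      unfolding sq by (rule integral_sum) (auto intro!: integrable_continuous_interval continuous_intros cont)
    also have "\<dots> = (\<Sum>k\<le>N. cnj (c (h k)) * J k)"
      unfolding J_def by (simp only: integral_mult_right)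
    finally have "complex_of_real (1 / T * integral {0..T} (\<lambda>t. (norm (f t))\<^sup>2)) =
        (\<Sum>k\<le>N. cnj (c (h k)) * ((1 / of_real T) * J k))"
      by (simp add: sum_divide_distrib)
    then show ?thesis unfolding J_def .
  qed
  have "((\<lambda>T. complex_of_real (1 / T * integral {0..T} (\<lambda>t. (norm (f t))\<^sup>2))) \<longlongrightarrow> (\<Sum>k\<le>N. cnj (c (h k)) * c (h k))) at_top"
    unfolding 2 by (intro tendsto_sum tendsto_mult tendsto_const 1) auto
  also have "(\<Sum>k\<le>N. cnj (c (h k)) * c (h k)) = complex_of_real (\<Sum>k\<le>N. (norm (c (h k)))\<^sup>2)"
    by (simp only: of_real_sum complex_norm_square mult.commute)
  also have "(\<Sum>k\<le>N. (norm (c (h k)))\<^sup>2) = (\<Sum>i\<in>I. (norm (c i))\<^sup>2)"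
    by (rule sum.reindex_bij_betw[OF h])
  finally show ?thesis by (simp only: tendsto_of_real_iff)
qed

lemma inj_on_prod_primes:
  fixes S :: "nat set"
  assumes S: "finite S" "\<And>p. p \<in> S \<Longrightarrow> prime p"
  shows "inj_on \<Prod> (Pow S)"
proof (rule inj_onI)
  fix X Y assume XY: "X \<in> Pow S" "Y \<in> Pow S" "\<Prod>X = \<Prod>Y"
  have mem: "p \<in> W \<longleftrightarrow> p dvd \<Prod>W" if "p \<in> S" "W \<subseteq> S" for p W
  proof
    assume "p dvd \<Prod>W"
    moreover have "finite W" "prime p" using that S finite_subset by auto
    ultimately obtain q where "q \<in> W" "p dvd q"
      using prime_dvd_prod_iff[of W p "\<lambda>x. x"] by auto
    then show "p \<in> W" using that S primes_dvd_imp_eq by blast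
  next
    assume "p \<in> W"
    moreover have "finite W" using that S finite_subset by auto
    ultimately show "p dvd \<Prod>W" using dvd_prodI[of W p "\<lambda>x. x"] by simp
  qed
  show "X = Y" using mem[of _ X] mem[of _ Y] XY by auto
qed

lemma mean_square_euler_product:
  fixes x :: real
  assumes S: "finite S" "\<And>p. p \<in> S \<Longrightarrow> prime p"
  shows "((\<lambda>T. 1 / T * integral {0..T} (\<lambda>t. (norm (\<Prod>p\<in>S. 1 - exp (- (Complex x t * ln (real p)))))\<^sup>2))
     \<longlongrightarrow> (\<Sum>X\<in>Pow S. real (\<Prod>X) powr (- (2 * x)))) at_top"
proof -
  define c where "c = (\<lambda>X. (- 1) ^ card X * complex_of_real (real (\<Prod>X) powr (- x)))"
  define w where "w = (\<lambda>X. - ln (real (\<Prod>X)))"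
  have pos: "\<Prod>X > 0" if "X \<in> Pow S" for X
    using that S prime_gt_0_nat by (intro prod_pos) auto
  have inj: "inj_on w (Pow S)"
  proof (rule inj_onI)
    fix X Y assume XY: "X \<in> Pow S" "Y \<in> Pow S" "w X = w Y"
    then have "ln (real (\<Prod>X)) = ln (real (\<Prod>Y))" by (simp add: w_def)
    then have "\<Prod>X = \<Prod>Y" using pos XY(1,2) by (subst (asm) ln_inj_iff) (auto simp del: of_nat_prod)
    then show "X = Y" using inj_on_prod_primes[OF S] XY by (auto dest: inj_onD)
  qed
  have "(\<Prod>p\<in>S. 1 - exp (- (Complex x t * ln (real p)))) = (\<Sum>X\<in>Pow S. c X * exp (\<i> * of_real t * of_real (w X)))" for t
  proof -
    have "(\<Prod>p\<in>S. 1 - exp (- (Complex x t * ln (real p)))) = (\<Prod>p\<in>S. - exp (- (Complex x t * ln (real p))) + 1)"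
      by simp
    also have "\<dots> = (\<Sum>X\<in>Pow S. (\<Prod>p\<in>X. - exp (- (Complex x t * ln (real p)))) * (\<Prod>p\<in>S-X. 1))"
      by (rule prod_add[OF S(1)])
    also have "\<dots> = (\<Sum>X\<in>Pow S. c X * exp (\<i> * of_real t * of_real (w X)))"
    proof (intro sum.cong refl)
      fix X assume X: "X \<in> Pow S"
      then have fin: "finite X" using S finite_subset by auto
      have lnX: "ln (real (\<Prod>X)) = (\<Sum>p\<in>X. ln (real p))"
        unfolding of_nat_prod using X S prime_gt_0_nat by (intro ln_prod fin) auto
      have "(\<Prod>p\<in>X. - exp (- (Complex x t * ln (real p)))) = (- 1) ^ card X * (\<Prod>p\<in>X. exp (- (Complex x t * ln (real p))))"
        by (rule prod_uminus)
      also have "(\<Prod>p\<in>X. exp (- (Complex x t * ln (real p)))) = exp (- (Complex x t * ln (real (\<Prod>X))))"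
        unfolding lnX exp_sum[OF fin, symmetric] by (simp add: sum_negf sum_distrib_left)
      also have "\<dots> = complex_of_real (real (\<Prod>X) powr (- x)) * exp (\<i> * of_real t * of_real (w X))"
        using pos[OF X] by (simp add: w_def powr_def exp_of_real[symmetric] exp_add[symmetric] Complex_eq algebra_simps del: of_nat_prod)
      finally show "(\<Prod>p\<in>X. - exp (- (Complex x t * ln (real p)))) * (\<Prod>p\<in>S-X. 1) = c X * exp (\<i> * of_real t * of_real (w X))"
        by (simp add: c_def)
    qed
    finally show ?thesis .
  qed
  moreover have "(\<Sum>X\<in>Pow S. (norm (c X))\<^sup>2) = (\<Sum>X\<in>Pow S. real (\<Prod>X) powr (- (2 * x)))"
  proof (intro sum.cong refl)
    fix X
    have "norm (c X) = real (\<Prod>X) powr (- x)" by (simp add: c_def norm_mult norm_power del: of_nat_prod)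
    then show "(norm (c X))\<^sup>2 = real (\<Prod>X) powr (- (2 * x))"
      by (simp add: power2_eq_square powr_add[symmetric] del: of_nat_prod)
  qed
  ultimately show ?thesis
    using mean_square_exponential_sum[OF _ _ inj, of c] S by auto
qed

section \<open>Negative moments of zeta on vertical lines\<close>

lemma continuous_on_zeta: "continuous_on (- {1}) zeta"
  using is_zeta_zeta unfolding is_zeta_def by (auto intro: holomorphic_on_imp_continuous_on)

lemma zeta_measurable [measurable]: "zeta \<in> borel_measurable borel"
proof -
  have "(\<lambda>s. indicator (- {1}) s *\<^sub>R zeta s) \<in> borel_measurable borel"
    by (rule borel_measurable_continuous_on_indicator[OF _ continuous_on_zeta]) auto
  also have "(\<lambda>s. indicator (- {1}) s *\<^sub>R zeta s) = zeta"
    using is_zeta_zeta by (auto simp: is_zeta_def split: split_indicator)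
  finally show ?thesis .
qed

lemma Complex_measurable [measurable]: "(\<lambda>t. Complex x t) \<in> borel_measurable borel"
  unfolding Complex_eq by measurable

lemma euler_square_coeff_sq_le: "(euler_square_coeff S n)\<^sup>2 \<le> (if \<exists>p\<in>S. p\<^sup>2 dvd n then 0 else 1)"
  by (simp add: euler_square_coeff_def power_mult[symmetric])

text \<open>
  The square of \<open>1 / y - \<kappa> y m\<close> is nonnegative, and \<open>1 / y\<^sup>2\<close> exceeds \<open>1 / y powr lam\<close> by at
  most \<open>1\<close>.
\<close>

lemma inverse_powr_lower_bound:
  fixes y m \<kappa> lam :: real
  assumes "y > 0" "lam \<ge> 2"
  shows "2 * \<kappa> * m \<le> 1 / y powr lam + 1 + \<kappa>\<^sup>2 * (y * m)\<^sup>2"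
proof -
  have "0 \<le> (1 / y - \<kappa> * (y * m))\<^sup>2" by simp
  also have "\<dots> = (1 / y)\<^sup>2 + \<kappa>\<^sup>2 * (y * m)\<^sup>2 - 2 * \<kappa> * m"
    using assms by (simp add: power2_diff power_mult_distrib)
  finally have 1: "2 * \<kappa> * m \<le> (1 / y)\<^sup>2 + \<kappa>\<^sup>2 * (y * m)\<^sup>2" by simp
  have "(1 / y)\<^sup>2 \<le> 1 / y powr lam + 1"
  proof (cases "y \<le> 1")
    case True
    have "y powr lam \<le> y powr 2" using assms True by (intro powr_mono') auto
    then have "1 / y\<^sup>2 \<le> 1 / y powr lam" using assms by (intro divide_left_mono) auto
    then show ?thesis by (simp add: power_divide)
  next
    case False
    then have "(1 / y)\<^sup>2 \<le> 1" by (simp add: power_le_one)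
    then show ?thesis by (simp add: add_increasing)
  qed
  with 1 show ?thesis by linarith
qed

text \<open>
  With \<open>k = 1 / 8200\<close> the mean of \<open>2 k |M|\<^sup>2 - k\<^sup>2 |zeta M\<^sup>2|\<^sup>2\<close> off \<open>E\<close> is at least
  \<open>k V - 4100 k\<^sup>2 V = V / 16400\<close>. The assumption that \<open>x\<close> is close to \<open>1/2\<close> makes \<open>V\<close> large enough
  to absorb the loss of \<open>1\<close> in passing from exponent \<open>2\<close> to \<open>lam\<close>.
\<close>

lemma zeta_negative_moment_large:
  fixes x lam :: real
  assumes x: "1 / 2 < x" "x < 1" and lam: "lam \<ge> 2"
    and x0: "131200 * (2 * x - 1) \<le> 1"
    and E[measurable]: "E \<in> sets borel" and Efin: "emeasure lborel E < \<infinity>"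
    and nz: "\<And>t. t \<notin> E \<Longrightarrow> zeta (Complex x t) \<noteq> 0"
  shows "eventually (\<lambda>T. ennreal (T / (131200 * (2 * x - 1))) \<le>
     (\<integral>\<^sup>+t\<in>{0..T} - E. ennreal (1 / norm (zeta (Complex x t)) powr lam) \<partial>lborel)) at_top"
proof -
  obtain S where S: "finite S" "\<And>p. p \<in> S \<Longrightarrow> prime p"
    and V1: "1 / (4 * (2 * x - 1)) \<le> (\<Sum>X\<in>Pow S. real (\<Prod>X) powr (- (2 * x)))"
    and V2: "\<And>N. (\<Sum>n | n \<in> {1..N} \<and> (\<forall>p\<in>S. \<not> p\<^sup>2 dvd n). real n powr (- (2 * x)))
        \<le> 2 * (\<Sum>X\<in>Pow S. real (\<Prod>X) powr (- (2 * x)))"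
    using squarefree_sum_large[of "2 * x"] x by auto
  define V where "V = (\<Sum>X\<in>Pow S. real (\<Prod>X) powr (- (2 * x)))"
  have V32800: "V \<ge> 32800"
  proof -
    have "32800 \<le> 1 / (4 * (2 * x - 1))" using x x0 by (simp add: field_simps)
    then show ?thesis using V1 unfolding V_def by linarith
  qed
  define M where "M = (\<lambda>s::complex. \<Prod>p\<in>S. 1 - exp (- (s * ln (real p))))"
  define Z where "Z = (\<lambda>s. zeta s * (M s)\<^sup>2)"
  define m where "m = (\<lambda>t. (norm (M (Complex x t)))\<^sup>2)"
  have contM: "continuous_on A (\<lambda>t. M (Complex x t))" for A
    unfolding M_def Complex_eq by (intro continuous_intros)
  have contm: "continuous_on A m" for A
    unfolding m_def by (intro continuous_intros contM)
  have [measurable]: "m \<in> borel_measurable borel"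
    by (rule borel_measurable_continuous_onI[OF contm])
  have Mm[measurable]: "(\<lambda>t. M (Complex x t)) \<in> borel_measurable borel"
    by (rule borel_measurable_continuous_onI[OF contM])
  have [measurable]: "(\<lambda>t. Z (Complex x t)) \<in> borel_measurable borel"
    unfolding Z_def by measurable
  obtain c where c: "error_transform (euler_square_coeff S) c Z"
    using error_transform_euler_square[OF S error_transform_zeta] unfolding Z_def M_def by blast
  obtain K where K: "K \<ge> 0" "\<And>X. X \<ge> 2 \<Longrightarrow>
     (\<integral>\<^sup>+t\<in>{-(X - 1)..X - 1}. ennreal ((norm (Z (Complex x t)))\<^sup>2) \<partial>lborel) \<le>
     ennreal (1024 * X * (\<Sum>n=1..nat \<lfloor>2 * X\<rfloor>. (euler_square_coeff S n)\<^sup>2 * real n powr (- (2 * x))) + K * X powr (2 - 2 * x))"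
    using mean_square_upper_bound[OF c, of x] x by auto
  have coeff: "(\<Sum>n=1..N. (euler_square_coeff S n)\<^sup>2 * real n powr (- (2 * x))) \<le> 2 * V" for N
  proof -
    have "(\<Sum>n=1..N. (euler_square_coeff S n)\<^sup>2 * real n powr (- (2 * x))) \<le>
      (\<Sum>n=1..N. if \<forall>p\<in>S. \<not> p\<^sup>2 dvd n then real n powr (- (2 * x)) else 0)"
    proof (intro sum_mono)
      fix n
      show "(euler_square_coeff S n)\<^sup>2 * real n powr (- (2 * x)) \<le> (if \<forall>p\<in>S. \<not> p\<^sup>2 dvd n then real n powr (- (2 * x)) else 0)"
        using mult_right_mono[OF euler_square_coeff_sq_le[of S n], of "real n powr (- (2 * x))"]
        by (auto split: if_splits)
    qed
    also have "\<dots> = (\<Sum>n | n \<in> {1..N} \<and> (\<forall>p\<in>S. \<not> p\<^sup>2 dvd n). real n powr (- (2 * x)))"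
      by (rule sum.inter_filter[symmetric]) simp
    also have "\<dots> \<le> 2 * V" unfolding V_def by (rule V2)
    finally show ?thesis .
  qed
  have upper: "eventually (\<lambda>T. (\<integral>\<^sup>+t\<in>{0..T}. ennreal ((norm (Z (Complex x t)))\<^sup>2) \<partial>lborel) \<le> ennreal (4100 * (T * V))) at_top"
  proof -
    have "((\<lambda>T. K * (T + 1) powr (2 - 2 * x) / T) \<longlongrightarrow> 0) at_top"
      using x by real_asymp
    then have "eventually (\<lambda>T. K * (T + 1) powr (2 - 2 * x) / T < 4) at_top"
      by (rule order_tendstoD) simp
    then show ?thesis using eventually_ge_at_top[of 1]
    proof eventually_elim
      case (elim T)
      have "(\<integral>\<^sup>+t\<in>{0..T}. ennreal ((norm (Z (Complex x t)))\<^sup>2) \<partial>lborel) \<le>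
         (\<integral>\<^sup>+t\<in>{-((T + 1) - 1)..(T + 1) - 1}. ennreal ((norm (Z (Complex x t)))\<^sup>2) \<partial>lborel)"
        using elim by (intro nn_integral_mono) (auto split: split_indicator)
      also have "\<dots> \<le> ennreal (1024 * (T + 1) * (\<Sum>n=1..nat \<lfloor>2 * (T + 1)\<rfloor>. (euler_square_coeff S n)\<^sup>2 * real n powr (- (2 * x))) + K * (T + 1) powr (2 - 2 * x))"
        using elim by (intro K(2)) auto
      also have "\<dots> \<le> ennreal (4100 * (T * V))"
      proof (rule ennreal_leI)
        have "1024 * (T + 1) * (\<Sum>n=1..nat \<lfloor>2 * (T + 1)\<rfloor>. (euler_square_coeff S n)\<^sup>2 * real n powr (- (2 * x))) \<le> 1024 * (2 * T) * (2 * V)"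
          using elim V32800 by (intro mult_mono coeff) (auto intro!: sum_nonneg)
        moreover have "K * (T + 1) powr (2 - 2 * x) \<le> 4 * T" using elim by (simp add: field_simps)
        moreover have "4 * T \<le> 4 * (T * V)" using elim V32800 by simp
        ultimately show "1024 * (T + 1) * (\<Sum>n=1..nat \<lfloor>2 * (T + 1)\<rfloor>. (euler_square_coeff S n)\<^sup>2 * real n powr (- (2 * x))) + K * (T + 1) powr (2 - 2 * x) \<le> 4100 * (T * V)"
          by simp
      qed
      finally show ?case .
    qed
  qed
  have "((\<lambda>T. 1 / T * integral {0..T} m) \<longlongrightarrow> V) at_top"
    unfolding m_def M_def V_def by (rule mean_square_euler_product[OF S])
  then have "eventually (\<lambda>T. 1 / T * integral {0..T} m > 3 / 4 * V) at_top"
    by (rule order_tendstoD) (use V32800 in simp)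
  then have lower: "eventually (\<lambda>T. ennreal (3 / 4 * (T * V)) \<le> (\<integral>\<^sup>+t\<in>{0..T}. ennreal (m t) \<partial>lborel)) at_top"
    using eventually_gt_at_top[of 0]
  proof eventually_elim
    case (elim T)
    have "(m has_integral integral {0..T} m) {0..T}"
      by (intro integrable_integral integrable_continuous_interval contm)
    then have "(\<integral>\<^sup>+t\<in>{0..T}. ennreal (m t) \<partial>lborel) = ennreal (integral {0..T} m)"
      by (rule nn_integral_has_integral_lebesgue'[rotated]) (simp add: m_def)
    moreover have "3 / 4 * (T * V) \<le> integral {0..T} m" using elim by (simp add: field_simps)
    ultimately show ?case by (simp add: ennreal_leI)
  qed
  obtain b where b: "b \<ge> 0" "\<And>t. m t \<le> b"
  proof
    show "m t \<le> (2 ^ card S)\<^sup>2" for t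
    proof -
      have "norm (M (Complex x t)) \<le> (\<Prod>p\<in>S. 2)"
        unfolding M_def prod_norm[symmetric]
      proof (rule prod_mono, safe)
        fix p assume p: "p \<in> S"
        have "norm (exp (- (Complex x t * ln (real p)))) \<le> 1"
          using x S(2)[OF p] prime_gt_0_nat by (simp add: mult_nonneg_nonneg Suc_leI)
        then show "norm (1 - exp (- (Complex x t * ln (real p)))) \<le> 2"
          using norm_triangle_ineq4[of 1 "exp (- (Complex x t * ln (real p)))"] unfolding norm_one by linarith
      qed auto
      then show ?thesis unfolding m_def by (intro power_mono) auto
    qed
  qed auto
  define e where "e = measure lborel E"
  have Ee: "emeasure lborel E = ennreal e" unfolding e_def using Efin by (intro emeasure_eq_ennreal_measure) auto
  have "eventually (\<lambda>T. T \<ge> 4 * (b * e)) at_top" by (rule eventually_ge_at_top)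
  with upper lower show ?thesis using eventually_gt_at_top[of 0]
  proof eventually_elim
    case (elim T)
    define k :: real where "k = 1 / 8200"
    have k0: "k \<ge> 0" by (simp add: k_def)
    let ?I = "\<integral>\<^sup>+t\<in>{0..T} - E. ennreal (1 / norm (zeta (Complex x t)) powr lam) \<partial>lborel"
    have "b * e \<le> T * V / 4"
    proof -
      have "b * e \<le> T * 1 / 4" using elim by simp
      also have "\<dots> \<le> T * V / 4" using elim V32800 by (intro divide_right_mono mult_left_mono) auto
      finally show ?thesis .
    qed
    have "(\<integral>\<^sup>+t\<in>{0..T}. ennreal (m t) \<partial>lborel) \<le>
      (\<integral>\<^sup>+t. ennreal (m t) * indicator ({0..T} - E) t + ennreal b * indicator E t \<partial>lborel)"
      by (intro nn_integral_mono) (auto split: split_indicator intro!: ennreal_leI b)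
    also have "\<dots> = (\<integral>\<^sup>+t\<in>{0..T} - E. ennreal (m t) \<partial>lborel) + ennreal b * ennreal e"
      by (subst nn_integral_add) (auto simp: nn_integral_cmult_indicator Ee)
    also have "ennreal b * ennreal e \<le> ennreal (T * V / 4)"
      using b \<open>b * e \<le> T * V / 4\<close> by (subst ennreal_mult[symmetric]) (auto simp: e_def intro!: ennreal_leI)
    finally have "(\<integral>\<^sup>+t\<in>{0..T}. ennreal (m t) \<partial>lborel) \<le>
        (\<integral>\<^sup>+t\<in>{0..T} - E. ennreal (m t) \<partial>lborel) + ennreal (T * V / 4)" by (simp add: add_left_mono)
    with elim(2) have A: "ennreal (3 / 4 * (T * V)) \<le> (\<integral>\<^sup>+t\<in>{0..T} - E. ennreal (m t) \<partial>lborel) + ennreal (T * V / 4)"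
      by (rule order_trans)
    have pt: "ennreal (2 * k) * (ennreal (m t) * indicator ({0..T} - E) t) \<le> ennreal (1 / norm (zeta (Complex x t)) powr lam) * indicator ({0..T} - E) t +
        (indicator {0..T} t + ennreal (k\<^sup>2) * (ennreal ((norm (Z (Complex x t)))\<^sup>2) * indicator {0..T} t))" for t
    proof (cases "t \<in> {0..T} - E")
      case True
      have "2 * k * m t \<le> 1 / norm (zeta (Complex x t)) powr lam + 1 + k\<^sup>2 * (norm (zeta (Complex x t)) * m t)\<^sup>2"
        using nz True by (intro inverse_powr_lower_bound lam) auto
      also have "norm (zeta (Complex x t)) * m t = norm (Z (Complex x t))"
        by (simp add: Z_def m_def norm_mult norm_power)
      finally have "ennreal (2 * k * m t) \<le> ennreal (1 / norm (zeta (Complex x t)) powr lam + (1 + k\<^sup>2 * (norm (Z (Complex x t)))\<^sup>2))"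
        by (intro ennreal_leI) simp
      also have "\<dots> = ennreal (1 / norm (zeta (Complex x t)) powr lam) + (1 + ennreal (k\<^sup>2) * ennreal ((norm (Z (Complex x t)))\<^sup>2))"
        by (simp only: ennreal_plus ennreal_mult zero_le_power2 mult_nonneg_nonneg add_nonneg_nonneg zero_le_one ennreal_1
            divide_nonneg_nonneg powr_ge_zero)
      finally show ?thesis using True k0 by (subst (asm) ennreal_mult) (simp_all add: m_def)
    qed simp
    define Jm where "Jm = (\<integral>\<^sup>+t\<in>{0..T} - E. ennreal (m t) \<partial>lborel)"
    define JZ where "JZ = (\<integral>\<^sup>+t\<in>{0..T}. ennreal ((norm (Z (Complex x t)))\<^sup>2) \<partial>lborel)"
    have e1: "ennreal (2 * k) * Jm = (\<integral>\<^sup>+t. ennreal (2 * k) * (ennreal (m t) * indicator ({0..T} - E) t) \<partial>lborel)"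
      unfolding Jm_def by (rule nn_integral_cmult[symmetric]) measurable
    have e2: "(\<integral>\<^sup>+t. ennreal (1 / norm (zeta (Complex x t)) powr lam) * indicator ({0..T} - E) t +
        (indicator {0..T} t + ennreal (k\<^sup>2) * (ennreal ((norm (Z (Complex x t)))\<^sup>2) * indicator {0..T} t)) \<partial>lborel)
        = ?I + (ennreal T + ennreal (k\<^sup>2) * JZ)"
    proof -
      have "(\<integral>\<^sup>+t. ennreal (k\<^sup>2) * (ennreal ((norm (Z (Complex x t)))\<^sup>2) * indicator {0..T} t) \<partial>lborel) = ennreal (k\<^sup>2) * JZ"
        unfolding JZ_def by (rule nn_integral_cmult) measurable
      moreover have "(\<integral>\<^sup>+t. indicator {0..T} t \<partial>lborel) = ennreal T" using elim by simp
      ultimately have e3: "(\<integral>\<^sup>+t. indicator {0..T} t + ennreal (k\<^sup>2) * (ennreal ((norm (Z (Complex x t)))\<^sup>2) * indicator {0..T} t) \<partial>lborel) =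
          ennreal T + ennreal (k\<^sup>2) * JZ"
        by (subst nn_integral_add) simp_all
      show ?thesis unfolding e3[symmetric] by (rule nn_integral_add) measurable
    qed
    have "ennreal (2 * k) * Jm \<le> ?I + (ennreal T + ennreal (k\<^sup>2) * JZ)"
      unfolding e1 e2[symmetric] by (rule nn_integral_mono) (rule pt)
    then have B: "ennreal (2 * k) * Jm \<le> ?I + (ennreal T + ennreal (k\<^sup>2) * ennreal (4100 * (T * V)))"
      by (rule order_trans) (intro add_left_mono mult_left_mono elim(1)[folded JZ_def]; simp)
    show ?case
    proof (cases "?I = \<infinity>")
      case False
      then obtain i where i: "i \<ge> 0" "?I = ennreal i" by (cases ?I) auto
      have TV: "T * V \<ge> 0" using elim V32800 by simp
      have "ennreal (2 * k * (3 / 4 * (T * V))) = ennreal (2 * k) * ennreal (3 / 4 * (T * V))"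
        using TV k0 by (intro ennreal_mult) auto
      also have "\<dots> \<le> ennreal (2 * k) * (Jm + ennreal (T * V / 4))"
        by (intro mult_left_mono A[folded Jm_def]) auto
      also have "\<dots> \<le> (ennreal i + (ennreal T + ennreal (k\<^sup>2) * ennreal (4100 * (T * V)))) + ennreal (2 * k) * ennreal (T * V / 4)"
        unfolding distrib_left using B i by (intro add_right_mono) simp
      also have "\<dots> = ennreal (i + (T + k\<^sup>2 * (4100 * (T * V))) + 2 * k * (T * V / 4))"
        using i elim TV k0 by (simp only: ennreal_mult[symmetric] ennreal_plus[symmetric] add_nonneg_nonneg
            mult_nonneg_nonneg zero_le_numeral zero_le_power2 divide_nonneg_nonneg less_imp_le)
      finally have "2 * k * (3 / 4 * (T * V)) \<le> i + (T + k\<^sup>2 * (4100 * (T * V))) + 2 * k * (T * V / 4)"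
      proof (subst (asm) ennreal_le_iff)
        show "0 \<le> i + (T + k\<^sup>2 * (4100 * (T * V))) + 2 * k * (T * V / 4)"
          using i elim(4) V32800 k0 by (intro add_nonneg_nonneg mult_nonneg_nonneg) auto
      qed
      then have "T * V / 16400 \<le> i + T" by (simp add: k_def power2_eq_square)
      moreover have "T * 32800 \<le> T * V" using elim V32800 by (intro mult_left_mono) auto
      ultimately have Vi: "T * V / 32800 \<le> i" by simp
      have "T * (1 / (4 * (2 * x - 1))) \<le> T * V" using elim V1 unfolding V_def by (intro mult_left_mono) auto
      then have "T * (1 / (4 * (2 * x - 1))) / 32800 \<le> T * V / 32800" by (rule divide_right_mono) simp
      also note Vi
      also have "T * (1 / (4 * (2 * x - 1))) / 32800 = T / (131200 * (2 * x - 1))" by simp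
      finally have "T / (131200 * (2 * x - 1)) \<le> i" .
      then show ?thesis unfolding i(2) by (rule ennreal_leI)
    qed simp
  qed
qed

section \<open>Integration over the strip\<close>

lemma lborel_complex_eq: "lborel = distr (lborel \<Otimes>\<^sub>M lborel) borel (\<lambda>(x, y). Complex x y)"
proof (rule lborel_eqI)
  have m: "(\<lambda>(x, y). Complex x y) \<in> lborel \<Otimes>\<^sub>M lborel \<rightarrow>\<^sub>M borel"
    unfolding Complex_eq by measurable
  fix l u :: complex
  assume le: "\<And>b. b \<in> Basis \<Longrightarrow> l \<bullet> b \<le> u \<bullet> b"
  have le': "Re l \<le> Re u" "Im l \<le> Im u" using le[of 1] le[of \<i>] by (auto simp: Basis_complex_def)
  have "(\<lambda>(x, y). Complex x y) -` box l u \<inter> space (lborel \<Otimes>\<^sub>M lborel) = {Re l<..<Re u} \<times> {Im l<..<Im u}"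
    by (auto simp: in_box_complex_iff space_pair_measure)
  then have "emeasure (distr (lborel \<Otimes>\<^sub>M lborel) borel (\<lambda>(x, y). Complex x y)) (box l u) =
      emeasure (lborel \<Otimes>\<^sub>M lborel) ({Re l<..<Re u} \<times> {Im l<..<Im u})"
    by (subst emeasure_distr[OF m]) auto
  also have "\<dots> = emeasure lborel {Re l<..<Re u} * emeasure lborel {Im l<..<Im u}"
    by (rule lborel.emeasure_pair_measure_Times) auto
  also have "\<dots> = ennreal ((Re u - Re l) * (Im u - Im l))"
    using le' by (simp add: ennreal_mult)
  also have "(Re u - Re l) * (Im u - Im l) = (\<Prod>b\<in>Basis. (u - l) \<bullet> b)"
    by (simp add: Basis_complex_def)
  finally show "emeasure (distr (lborel \<Otimes>\<^sub>M lborel) borel (\<lambda>(x, y). Complex x y)) (box l u) = ennreal (\<Prod>b\<in>Basis. (u - l) \<bullet> b)" .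
qed simp

lemma nn_integral_complex_iterated:
  assumes [measurable]: "f \<in> borel_measurable borel"
  shows "(\<integral>\<^sup>+s. f s \<partial>lborel) = (\<integral>\<^sup>+x. (\<integral>\<^sup>+t. f (Complex x t) \<partial>lborel) \<partial>lborel)"
proof -
  have m[measurable]: "(\<lambda>(x, y). Complex x y) \<in> lborel \<Otimes>\<^sub>M lborel \<rightarrow>\<^sub>M borel"
    unfolding Complex_eq by measurable
  have "(\<integral>\<^sup>+s. f s \<partial>lborel) = (\<integral>\<^sup>+w. f (case w of (x, y) \<Rightarrow> Complex x y) \<partial>(lborel \<Otimes>\<^sub>M lborel))"
    by (subst lborel_complex_eq, subst nn_integral_distr[OF m]) simp_all
  also have "\<dots> = (\<integral>\<^sup>+x. (\<integral>\<^sup>+t. f (Complex x t) \<partial>lborel) \<partial>lborel)"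
    by (subst lborel.nn_integral_fst[symmetric]) simp_all
  finally show ?thesis .
qed

lemma summable_disc_radius:
  assumes "\<alpha> > 1" "\<And>k::nat. k \<ge> 1 \<Longrightarrow> real k + N0 > 0"
  shows "summable (\<lambda>k. disc_radius \<alpha> N0 (Suc k))"
proof (rule summable_comparison_test_ev)
  show "summable (\<lambda>k. 2 powr \<alpha> * real (Suc k) powr (- \<alpha>))"
    using assms(1) summable_real_powr_iff[of "- \<alpha>"] by (intro summable_mult) (subst summable_Suc_iff, simp)
  have "eventually (\<lambda>k. real k \<ge> 2 * \<bar>N0\<bar>) sequentially"
    by (rule eventually_compose_filterlim[OF eventually_ge_at_top filterlim_real_sequentially])
  then show "eventually (\<lambda>k. norm (disc_radius \<alpha> N0 (Suc k)) \<le> 2 powr \<alpha> * real (Suc k) powr (- \<alpha>)) sequentially"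
  proof eventually_elim
    case (elim k)
    have "(real (Suc k) + N0) powr (- \<alpha>) \<le> (real (Suc k) / 2) powr (- \<alpha>)"
      using elim assms(1) by (intro powr_mono2') auto
    also have "\<dots> = 2 powr \<alpha> * real (Suc k) powr (- \<alpha>)"
      by (simp add: powr_divide powr_minus_divide del: of_nat_Suc)
    finally show ?case by (simp add: disc_radius_def)
  qed
qed

text \<open>
  The integral from \<open>a + h\<close> is a multiple of \<open>ln (1 / h)\<close> up to a constant.
\<close>

lemma nn_integral_inverse_infinite:
  fixes c a b :: real
  assumes "c > 0" "a < b"
  shows "(\<integral>\<^sup>+x\<in>{a<..<b}. ennreal (c / (x - a)) \<partial>lborel) = \<infinity>"
proof (rule ccontr)
  assume "(\<integral>\<^sup>+x\<in>{a<..<b}. ennreal (c / (x - a)) \<partial>lborel) \<noteq> \<infinity>"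
  then obtain i where i: "i \<ge> 0" "(\<integral>\<^sup>+x\<in>{a<..<b}. ennreal (c / (x - a)) \<partial>lborel) = ennreal i"
    by (cases "\<integral>\<^sup>+x\<in>{a<..<b}. ennreal (c / (x - a)) \<partial>lborel") auto
  define d where "d = (a + b) / 2"
  have d: "a < d" "d < b" using assms by (auto simp: d_def)
  have le: "c * (ln (d - a) - ln h) \<le> i" if h: "0 < h" "a + h \<le> d" for h
  proof -
    have "(\<integral>\<^sup>+x. ennreal (c / (x - a)) * indicator {a + h..d} x \<partial>lborel) = ennreal (c * ln (d - a) - c * ln (a + h - a))"
      using h assms by (intro nn_integral_FTC_Icc) (auto intro!: derivative_eq_intros simp: field_simps)
    moreover have "(\<integral>\<^sup>+x. ennreal (c / (x - a)) * indicator {a + h..d} x \<partial>lborel) \<le> (\<integral>\<^sup>+x\<in>{a<..<b}. ennreal (c / (x - a)) \<partial>lborel)"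
      using h d by (intro nn_integral_mono) (auto split: split_indicator)
    ultimately show ?thesis using i by (simp add: right_diff_distrib)
  qed
  \<comment> \<open>The value of \<open>h\<close> for which the left-hand side of \<open>le\<close> equals \<open>i + 1\<close>.\<close>
  define h where "h = (d - a) * exp (- ((i + 1) / c))"
  have h: "0 < h" using d by (simp add: h_def)
  have "exp (- ((i + 1) / c)) \<le> 1" using i assms by simp
  then have "h \<le> (d - a) * 1" unfolding h_def using d by (intro mult_left_mono) auto
  then have "a + h \<le> d" by simp
  from le[OF h this] have "c * (ln (d - a) - ln h) \<le> i" .
  moreover have "ln h = ln (d - a) - (i + 1) / c" using d by (simp add: h_def ln_mult)
  ultimately show False using assms by simp
qed

theorem mainTheorem3:
  fixes lam p \<alpha> N0 :: real and \<rho> :: "nat \<Rightarrow> complex"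
  assumes "lam \<ge> 2" and "0 < p" and "p < 1"
    and "\<alpha> > 1" and "\<And>k::nat. k \<ge> 1 \<Longrightarrow> real k + N0 > 0"
    and "lists_nontrivial_zeros \<rho>"
    and "\<exists>z \<in> nontrivial_zeros. Re z \<noteq> 1/2"
  shows "((\<lambda>R::real. reg_area_integral \<rho> \<alpha> N0 lam p R) \<longlongrightarrow> \<infinity>) at_top"
proof (rule tendsto_at_topI_sequentially)
  fix X :: "nat \<Rightarrow> real"
  assume X: "filterlim X at_top sequentially"
  let ?r = "disc_radius \<alpha> N0"
  define E where "E = (\<Union>k\<in>{1..}. {Im (\<rho> k) - ?r k<..<Im (\<rho> k) + ?r k})"
  \<comment> \<open>Only abscissae so close to \<open>1/2\<close> that \<open>zeta_negative_moment_large\<close> applies are used.\<close>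
  define b :: real where "b = 1 / 2 + 1 / 262400"
  define g where "g = (\<lambda>s. ennreal (1 / norm (zeta s) powr lam))"
  have [measurable]: "g \<in> borel_measurable borel" unfolding g_def by measurable
  have E[measurable]: "E \<in> sets borel" unfolding E_def by measurable
  have r0: "?r k > 0" if "k \<ge> 1" for k using assms(5)[OF that] by (simp add: disc_radius_def)
  have Efin: "emeasure lborel E < \<infinity>"
  proof -
    have "E \<subseteq> (\<Union>k. {Im (\<rho> (Suc k)) - ?r (Suc k)<..<Im (\<rho> (Suc k)) + ?r (Suc k)})"
    proof
      fix t assume "t \<in> E"
      then obtain k where "k \<ge> 1" "t \<in> {Im (\<rho> k) - ?r k<..<Im (\<rho> k) + ?r k}" by (auto simp: E_def)
      then show "t \<in> (\<Union>k. {Im (\<rho> (Suc k)) - ?r (Suc k)<..<Im (\<rho> (Suc k)) + ?r (Suc k)})"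
        by (intro UN_I[of "k - 1"]) auto
    qed
    then have "emeasure lborel E \<le> emeasure lborel (\<Union>k. {Im (\<rho> (Suc k)) - ?r (Suc k)<..<Im (\<rho> (Suc k)) + ?r (Suc k)})"
      by (rule emeasure_mono) measurable
    also have "\<dots> \<le> (\<Sum>k. emeasure lborel {Im (\<rho> (Suc k)) - ?r (Suc k)<..<Im (\<rho> (Suc k)) + ?r (Suc k)})"
      by (rule emeasure_subadditive_countably) auto
    also have "\<dots> = (\<Sum>k. ennreal (2 * ?r (Suc k)))"
      using r0 by (intro suminf_cong) (simp add: less_imp_le)
    also have "\<dots> = ennreal (\<Sum>k. 2 * ?r (Suc k))"
      using r0 by (intro suminf_ennreal2 summable_mult summable_disc_radius assms(4,5)) (auto intro: less_imp_le)
    finally show ?thesis by (rule le_less_trans) simp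
  qed
  \<comment> \<open>Every zero is the centre of a disc of positive radius, so \<open>1 / 0 = 0\<close> does not occur off \<open>E\<close>.\<close>
  have nz: "zeta (Complex x t) \<noteq> 0" if x: "x \<in> {1/2<..<b}" and t: "t \<notin> E" for x t
  proof
    assume "zeta (Complex x t) = 0"
    then have "Complex x t \<in> nontrivial_zeros" using x by (auto simp: nontrivial_zeros_def b_def)
    then obtain k where "k \<ge> 1" "\<rho> k = Complex x t"
      using assms(6) unfolding lists_nontrivial_zeros_def by (metis atLeast_iff imageE)
    then have "t \<in> E" unfolding E_def using r0[of k] by (intro UN_I[of k]) auto
    then show False using t by simp
  qed
  have dom: "Complex x t \<in> reg_domain \<rho> \<alpha> N0 R" if x: "x \<in> {1/2<..<b}" and t: "t \<in> {0..R} - E" for x t R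
  proof -
    have "Complex x t \<notin> ball (\<rho> k) (?r k)" if "k \<ge> 1" for k
    proof
      assume "Complex x t \<in> ball (\<rho> k) (?r k)"
      then have "\<bar>Im (\<rho> k) - t\<bar> < ?r k"
        using abs_Im_le_cmod[of "\<rho> k - Complex x t"] by (simp add: dist_norm)
      then have "t \<in> E" unfolding E_def using that by (intro UN_I[of k]) (auto simp: abs_less_iff)
      then show False using t by simp
    qed
    then show ?thesis using x t by (auto simp: reg_domain_def b_def)
  qed
  have dm[measurable]: "reg_domain \<rho> \<alpha> N0 R \<in> sets borel" for R
    unfolding reg_domain_def by measurable
  define h where "h = (\<lambda>R x. ennreal (1 / (2 * R)) * (\<integral>\<^sup>+t\<in>{0..R} - E. g (Complex x t) \<partial>lborel) * indicator {1/2<..<b} x)"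
  have [measurable]: "(\<lambda>(x, t). Complex x t) \<in> lborel \<Otimes>\<^sub>M lborel \<rightarrow>\<^sub>M borel"
    unfolding Complex_eq by measurable
  have gm[measurable]: "(\<lambda>(x, t). g (Complex x t)) \<in> borel_measurable (lborel \<Otimes>\<^sub>M lborel)"
    by measurable
  have hm: "h R \<in> borel_measurable lborel" for R
    unfolding h_def by measurable
  have lower: "(\<integral>\<^sup>+x. h R x \<partial>lborel) \<le> reg_area_integral \<rho> \<alpha> N0 lam p R" for R
  proof -
    let ?w = "\<lambda>s. ennreal (1 / (norm (zeta s) powr lam * \<bar>Re s - 1/2\<bar> powr p)) * indicator (reg_domain \<rho> \<alpha> N0 R) s"
    have "(\<integral>\<^sup>+x. h R x \<partial>lborel) =
      (\<integral>\<^sup>+x. ennreal (1 / (2 * R)) * ((\<integral>\<^sup>+t\<in>{0..R} - E. g (Complex x t) \<partial>lborel) * indicator {1/2<..<b} x) \<partial>lborel)"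
      unfolding h_def by (simp only: mult.assoc)
    also have "\<dots> = ennreal (1 / (2 * R)) * (\<integral>\<^sup>+x. (\<integral>\<^sup>+t\<in>{0..R} - E. g (Complex x t) \<partial>lborel) * indicator {1/2<..<b} x \<partial>lborel)"
      by (rule nn_integral_cmult) measurable
    also have "\<dots> \<le> ennreal (1 / (2 * R)) * (\<integral>\<^sup>+x. (\<integral>\<^sup>+t. ?w (Complex x t) \<partial>lborel) \<partial>lborel)"
    proof (intro mult_left_mono nn_integral_mono)
      fix x
      show "(\<integral>\<^sup>+t\<in>{0..R} - E. g (Complex x t) \<partial>lborel) * indicator {1/2<..<b} x \<le> (\<integral>\<^sup>+t. ?w (Complex x t) \<partial>lborel)"
      proof (cases "x \<in> {1/2<..<b}")
        case True
        have "(\<integral>\<^sup>+t\<in>{0..R} - E. g (Complex x t) \<partial>lborel) \<le> (\<integral>\<^sup>+t. ?w (Complex x t) \<partial>lborel)"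
        proof (rule nn_integral_mono)
          fix t
          show "g (Complex x t) * indicator ({0..R} - E) t \<le> ?w (Complex x t)"
          proof (cases "t \<in> {0..R} - E")
            case t: True
            have pos: "0 < norm (zeta (Complex x t)) powr lam" using nz[OF True] t by simp
            have "\<bar>x - 1/2\<bar> powr p \<le> 1" "0 < \<bar>x - 1/2\<bar> powr p"
              using True assms(2) by (auto intro!: powr_le1 simp: b_def)
            then have "1 / norm (zeta (Complex x t)) powr lam \<le> 1 / (norm (zeta (Complex x t)) powr lam * \<bar>x - 1/2\<bar> powr p)"
              using pos by (intro divide_left_mono) (auto simp: mult_left_le)
            then show ?thesis using t dom[OF True t] by (auto simp: g_def intro!: ennreal_leI)
          qed simp
        qed
        then show ?thesis using True by simp
      qed simp
    qed simp
    also have "(\<integral>\<^sup>+x. (\<integral>\<^sup>+t. ?w (Complex x t) \<partial>lborel) \<partial>lborel) = (\<integral>\<^sup>+s. ?w s \<partial>lborel)"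
      by (rule nn_integral_complex_iterated[symmetric]) measurable
    finally show ?thesis unfolding reg_area_integral_def .
  qed
  have "\<infinity> = (\<integral>\<^sup>+x\<in>{1/2<..<b}. ennreal (1 / 524800 / (x - 1/2)) \<partial>lborel)"
    by (rule nn_integral_inverse_infinite[symmetric]) (auto simp: b_def)
  also have "\<dots> \<le> (\<integral>\<^sup>+x. liminf (\<lambda>n. h (X n) x) \<partial>lborel)"
  proof (rule nn_integral_mono)
    fix x :: real
    show "ennreal (1 / 524800 / (x - 1/2)) * indicator {1/2<..<b} x \<le> liminf (\<lambda>n. h (X n) x)"
    proof (cases "x \<in> {1/2<..<b}")
      case True
      have "eventually (\<lambda>R. ennreal (R / (131200 * (2 * x - 1))) \<le> (\<integral>\<^sup>+t\<in>{0..R} - E. g (Complex x t) \<partial>lborel)) at_top"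
        unfolding g_def using True nz[OF True]
        by (intro zeta_negative_moment_large assms(1) E Efin) (auto simp: b_def)
      then have "eventually (\<lambda>R. ennreal (1 / 524800 / (x - 1/2)) \<le> h R x) at_top"
        using eventually_gt_at_top[of 0]
      proof eventually_elim
        case (elim R)
        have "1 / 524800 / (x - 1/2) = 1 / (2 * R) * (R / (131200 * (2 * x - 1)))"
          using elim True by (simp add: field_simps)
        then have "ennreal (1 / 524800 / (x - 1/2)) = ennreal (1 / (2 * R)) * ennreal (R / (131200 * (2 * x - 1)))"
          using elim True by (simp add: ennreal_mult[symmetric])
        also have "\<dots> \<le> h R x" using elim True unfolding h_def by (simp add: mult_left_mono)
        finally show ?case .
      qed
      then have "eventually (\<lambda>n. ennreal (1 / 524800 / (x - 1/2)) \<le> h (X n) x) sequentially"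
        by (rule eventually_compose_filterlim[OF _ X])
      then show ?thesis using True by (simp add: Liminf_bounded)
    qed simp
  qed
  also have "\<dots> \<le> liminf (\<lambda>n. \<integral>\<^sup>+x. h (X n) x \<partial>lborel)"
    by (rule nn_integral_liminf) (rule hm)
  also have "\<dots> \<le> liminf (\<lambda>n. reg_area_integral \<rho> \<alpha> N0 lam p (X n))"
    by (intro Liminf_mono always_eventually allI lower)
  finally have "liminf (\<lambda>n. reg_area_integral \<rho> \<alpha> N0 lam p (X n)) = \<infinity>"
    by (simp add: top_unique)
  moreover have "liminf (\<lambda>n. reg_area_integral \<rho> \<alpha> N0 lam p (X n)) \<le> limsup (\<lambda>n. reg_area_integral \<rho> \<alpha> N0 lam p (X n))"
    by (rule Liminf_le_Limsup) simp
  ultimately show "(\<lambda>n. reg_area_integral \<rho> \<alpha> N0 lam p (X n)) \<longlonglongrightarrow> \<infinity>"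
    by (intro tendsto_iff_Liminf_eq_Limsup[THEN iffD2]) (auto simp: top_unique)
qed

end
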